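(* Let $k\in\mathbb N$ with $k\le|\mathsf V|$ and $p\in[1,\infty]$. Let $\mathsf G=(\mathsf V,\mathsf E,\nu,\omega)$ be a weighted graph with $\nu(\mathsf V)<\infty$ such that: (i) there exists $C>0$ such that for all $\mathsf V_0\subset\mathsf V$ that induce a connected subgraph and all $f\in D(\mathcal Q^{\mathrm N}_{\mathsf V_0})$ with $\sum_{\mathsf v\in\mathsf V_0}\nu(\mathsf v)f(\mathsf v)=0$ one has $\|f\|_{\ell^\infty(\mathsf V_0)}\le C\,\mathcal Q^{\mathrm N}_{\mathsf V_0}(f)^{1/2}$; (ii) for any two vertices $\mathsf v\ne\mathsf w$ in $\mathsf V$ there are only finitely many non-contractible paths in $\mathsf G$ connecting $\mathsf v$ and $\mathsf w$. Then there exists a $k$-partition $\mathcal P\in\mathfrak C_k(\mathsf G)$ with $$\mathfrak L^{\mathrm N}_{k,p}(\mathsf G)=\Lambda^{\mathrm N}_{k,p}(\mathcal P).$$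
   Context: Graph setting: $\mathsf G$ is a finite or countably infinite, simple, connected graph with vertex weights $\nu:\mathsf V\to(0,\infty)$ and edge weights $\omega:\mathsf E\to(0,\infty)$, with $\sum_{\mathsf e\ni\mathsf v}\omega(\mathsf e)<\infty$ for every $\mathsf v$; $\nu(\mathsf S)=\sum_{\mathsf v\in\mathsf S}\nu(\mathsf v)$. For $\mathsf V_0\subset\mathsf V$, $\ell^2_\nu(\mathsf V_0)$ has norm $\|g\|^2=\sum_{\mathsf v\in\mathsf V_0}\nu(\mathsf v)|g(\mathsf v)|^2$. Neumann form: for nonempty $\mathsf V_0\subset\mathsf V$ (including $\mathsf V_0=\mathsf V$), $\mathsf E_0$ is the set of edges with both endpoints in $\mathsf V_0$, $\partial\mathsf V_0$ the set of edges between $\mathsf V_0$ and $\mathsf V\setminus\mathsf V_0$, $\delta\mathsf V_0$ the set of vertices of $\mathsf V\setminus\mathsf V_0$ adjacent to some vertex of $\mathsf V_0$, and $\overline{\mathsf E_0}=\mathsf E_0\cup\partial\mathsf V_0$. For $g:\mathsf V_0\to\mathbb C$ the Neumann extension $E^{\mathrm N}_{\mathsf V_0}g:\mathsf V\to\mathbb C$ equals $g$ on $\mathsf V_0$, equals $\frac{\sum_{\mathsf w\in\mathsf V_0:\{\mathsf v,\mathsf w\}\in\partial\mathsf V_0}\omega(\{\mathsf v,\mathsf w\})g(\mathsf w)}{\sum_{\mathsf w\in\mathsf V_0:\{\mathsf v,\mathsf w\}\in\partial\mathsf V_0}\omega(\{\mathsf v,\mathsf w\})}$ at $\mathsf v\in\delta\mathsf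 V_0$, and $0$ elsewhere. Put $$\mathcal Q^{\mathrm N}_{\mathsf V_0}(g)=\sum_{\mathsf e=\{\mathsf v,\mathsf w\}\in\overline{\mathsf E_0}}\omega(\mathsf e)|E^{\mathrm N}_{\mathsf V_0}g(\mathsf v)-E^{\mathrm N}_{\mathsf V_0}g(\mathsf w)|^2,$$ with domain $D(\mathcal Q^{\mathrm N}_{\mathsf V_0})=\{g\in\ell^2_\nu(\mathsf V_0):\mathcal Q^{\mathrm N}_{\mathsf V_0}(g)<\infty\}$ (the sums defining $E^{\mathrm N}_{\mathsf V_0}g$ being understood to converge absolutely). The Neumann energy is $$\lambda_2^{\mathrm N}(\mathsf V_0)=\min\left\{\frac{\mathcal Q^{\mathrm N}_{\mathsf V_0}(g)}{\|g\|^2_{\ell^2_\nu(\mathsf V_0)}}: g\in D(\mathcal Q^{\mathrm N}_{\mathsf V_0})\setminus\{0\},\ \sum_{\mathsf v\in\mathsf V_0}\nu(\mathsf v)g(\mathsf v)=0\right\},$$ with $\lambda_2^{\mathrm N}(\mathsf V_0)=\infty$ if $|\mathsf V_0|=1$. Paths: a path between $\mathsf v$ and $\mathsf w$ is a finite sequence of pairwise distinct vertices starting at $\mathsf v$ and ending at $\mathsf w$ with consecutive vertices adjacent in $\mathsf G$. It is non-contractible if any two of its vertices that are adjacent in $\mathsf G$ are consecutive in the path. Partitions: a $k$-partition $\mathcal P=(\mathsf V_j)_{1\le j\le k}$ is a family of nonempty, pairwise disjoint subsets of $\mathsf V$ with union $\mathsf V$; $\mathfrak C_k(\mathsf G)$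 is the set of those for which each $\mathsf V_j$ induces a connected subgraph. $\Lambda^{\mathrm N}_{k,p}(\mathcal P)=\bigl(\frac1k\sum_{j=1}^k\lambda_2^{\mathrm N}(\mathsf V_j)^p\bigr)^{1/p}$ for $1\le p<\infty$, $\Lambda^{\mathrm N}_{k,\infty}(\mathcal P)=\max_j\lambda_2^{\mathrm N}(\mathsf V_j)$, and $\mathfrak L^{\mathrm N}_{k,p}(\mathsf G)=\inf_{\mathcal P\in\mathfrak C_k(\mathsf G)}\Lambda^{\mathrm N}_{k,p}(\mathcal P)$ (values in $[0,\infty]$). *)

theory Defs
  imports "HOL-Analysis.Analysis"
begin

record 'a wgraph =
  verts :: "'a set"
  edges :: "'a set set"
  vweight :: "'a \<Rightarrow> real"
  eweight :: "'a set \<Rightarrow> real"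

definition adjacent :: "'a wgraph \<Rightarrow> 'a \<Rightarrow> 'a \<Rightarrow> bool" where
  "adjacent G v w \<longleftrightarrow> {v, w} \<in> edges G"

definition graph_path :: "'a wgraph \<Rightarrow> 'a \<Rightarrow> 'a \<Rightarrow> 'a list \<Rightarrow> bool" where
  "graph_path G v w xs \<longleftrightarrow>
     xs \<noteq> [] \<and> hd xs = v \<and> last xs = w \<and> set xs \<subseteq> verts G \<and> distinct xs \<and>
     successively (adjacent G) xs"

definition non_contractible :: "'a wgraph \<Rightarrow> 'a list \<Rightarrow> bool" where
  "non_contractible G xs \<longleftrightarrow>
     (\<forall>i j. i < j \<and> j < length xs \<and> adjacent G (xs ! i) (xs ! j) \<longrightarrow> j = Suc i)"

definition induces_connected :: "'a wgraph \<Rightarrow> 'a set \<Rightarrow> bool" where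
  "induces_connected G S \<longleftrightarrow>
     S \<noteq> {} \<and> S \<subseteq> verts G \<and>
     (\<forall>v\<in>S. \<forall>w\<in>S. \<exists>xs. graph_path G v w xs \<and> set xs \<subseteq> S)"

text \<open>Infinite sums of nonnegative quantities are taken in \<^typ>\<open>ennreal\<close>, where they always exist.\<close>

definition weighted_graph :: "'a wgraph \<Rightarrow> bool" where
  "weighted_graph G \<longleftrightarrow>
     countable (verts G) \<and>
     (\<forall>e\<in>edges G. e \<subseteq> verts G \<and> card e = 2) \<and>
     induces_connected G (verts G) \<and>
     (\<forall>v\<in>verts G. vweight G v > 0) \<and>
     (\<forall>e\<in>edges G. eweight G e > 0) \<and>
     (\<forall>v\<in>verts G. (\<Sum>\<^sub>\<infinity>e\<in>{e \<in> edges G. v \<in> e}. ennreal (eweight G e)) < \<infinity>)"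

definition vmeasure :: "'a wgraph \<Rightarrow> 'a set \<Rightarrow> ennreal" where
  "vmeasure G S = (\<Sum>\<^sub>\<infinity>v\<in>S. ennreal (vweight G v))"

text \<open>A function on a vertex set \<open>S\<close> is represented by a total function whose values outside \<open>S\<close>
  are irrelevant: everything below depends only on its restriction to \<open>S\<close>.\<close>

definition l2_norm_sq :: "'a wgraph \<Rightarrow> 'a set \<Rightarrow> ('a \<Rightarrow> complex) \<Rightarrow> ennreal" where
  "l2_norm_sq G S g = (\<Sum>\<^sub>\<infinity>v\<in>S. ennreal (vweight G v * (cmod (g v))\<^sup>2))"

definition inner_edges :: "'a wgraph \<Rightarrow> 'a set \<Rightarrow> 'a set set" where
  "inner_edges G S = {e \<in> edges G. e \<subseteq> S}"

definition edge_boundary :: "'a wgraph \<Rightarrow> 'a set \<Rightarrow> 'a set set" where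
  "edge_boundary G S = {e \<in> edges G. \<exists>v\<in>S. \<exists>w\<in>verts G - S. e = {v, w}}"

definition vertex_boundary :: "'a wgraph \<Rightarrow> 'a set \<Rightarrow> 'a set" where
  "vertex_boundary G S = {v \<in> verts G - S. \<exists>w\<in>S. adjacent G v w}"

definition boundary_neighbours :: "'a wgraph \<Rightarrow> 'a set \<Rightarrow> 'a \<Rightarrow> 'a set" where
  "boundary_neighbours G S v = {w \<in> S. {v, w} \<in> edge_boundary G S}"

definition neumann_ext :: "'a wgraph \<Rightarrow> 'a set \<Rightarrow> ('a \<Rightarrow> complex) \<Rightarrow> 'a \<Rightarrow> complex" where
  "neumann_ext G S g v =
     (if v \<in> S then g v
      else if v \<in> vertex_boundary G S then
        (\<Sum>\<^sub>\<infinity>w\<in>boundary_neighbours G S v. complex_of_real (eweight G {v, w}) * g w) /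
        complex_of_real (\<Sum>\<^sub>\<infinity>w\<in>boundary_neighbours G S v. eweight G {v, w})
      else 0)"

text \<open>The value \<open>|f v - f w|\<^sup>2\<close> for an unordered edge \<open>e = {v, w}\<close>; it is symmetric in
  \<open>v\<close> and \<open>w\<close>, so the description is unique.\<close>

definition edge_diff_sq :: "('a \<Rightarrow> complex) \<Rightarrow> 'a set \<Rightarrow> real" where
  "edge_diff_sq f e = (THE d. \<exists>v w. e = {v, w} \<and> d = (cmod (f v - f w))\<^sup>2)"

definition neumann_form :: "'a wgraph \<Rightarrow> 'a set \<Rightarrow> ('a \<Rightarrow> complex) \<Rightarrow> ennreal" where
  "neumann_form G S g =
     (\<Sum>\<^sub>\<infinity>e\<in>inner_edges G S \<union> edge_boundary G S.
        ennreal (eweight G e * edge_diff_sq (neumann_ext G S g) e))"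

text \<open>An \<^const>\<open>infsum\<close> that does not converge is \<open>0\<close>, so the absolute convergence of the sums in
  \<^const>\<open>neumann_ext\<close> has to be part of the form domain.\<close>

definition neumann_domain :: "'a wgraph \<Rightarrow> 'a set \<Rightarrow> ('a \<Rightarrow> complex) set" where
  "neumann_domain G S = {g.
     l2_norm_sq G S g < \<infinity> \<and>
     (\<forall>v\<in>vertex_boundary G S.
        (\<lambda>w. cmod (complex_of_real (eweight G {v, w}) * g w)) summable_on boundary_neighbours G S v) \<and>
     neumann_form G S g < \<infinity>}"

definition mean_zero :: "'a wgraph \<Rightarrow> 'a set \<Rightarrow> ('a \<Rightarrow> complex) \<Rightarrow> bool" where
  "mean_zero G S g \<longleftrightarrow> ((\<lambda>v. complex_of_real (vweight G v) * g v) has_sum 0) S"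

definition neumann_energy :: "'a wgraph \<Rightarrow> 'a set \<Rightarrow> ennreal" where
  "neumann_energy G S =
     (if card S = 1 then \<infinity>
      else Inf {neumann_form G S g / l2_norm_sq G S g | g.
             g \<in> neumann_domain G S \<and> (\<exists>v\<in>S. g v \<noteq> 0) \<and> mean_zero G S g})"

text \<open>The power \<open>x\<^sup>r\<close> on \<open>[0,\<infinity>]\<close> for an exponent \<open>r > 0\<close>.\<close>

definition ennpowr :: "ennreal \<Rightarrow> real \<Rightarrow> ennreal" where
  "ennpowr x r = (if x = \<infinity> then \<infinity> else ennreal (enn2real x powr r))"

text \<open>A \<open>k\<close>-partition is a family indexed by \<open>{1..k}\<close>; the values at other indices are irrelevant.\<close>

definition connected_partitions :: "'a wgraph \<Rightarrow> nat \<Rightarrow> (nat \<Rightarrow> 'a set) set" where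
  "connected_partitions G k = {P.
     (\<forall>j\<in>{1..k}. P j \<noteq> {}) \<and> disjoint_family_on P {1..k} \<and> (\<Union>j\<in>{1..k}. P j) = verts G \<and>
     (\<forall>j\<in>{1..k}. induces_connected G (P j))}"

definition partition_energy :: "'a wgraph \<Rightarrow> nat \<Rightarrow> ennreal \<Rightarrow> (nat \<Rightarrow> 'a set) \<Rightarrow> ennreal" where
  "partition_energy G k p P =
     (if p = \<infinity> then Max ((\<lambda>j. neumann_energy G (P j)) ` {1..k})
      else ennpowr ((\<Sum>j=1..k. ennpowr (neumann_energy G (P j)) (enn2real p)) / of_nat k)
             (1 / enn2real p))"

definition optimal_energy :: "'a wgraph \<Rightarrow> nat \<Rightarrow> ennreal \<Rightarrow> ennreal" where
  "optimal_energy G k p = (INF P\<in>connected_partitions G k. partition_energy G k p P)"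

end

theory Submission
  imports Defs "HOL-Complex_Analysis.Great_Picard"
begin

text \<open>The direct method. A minimising sequence of partitions has a subsequence along which every
  vertex eventually stays in the part with a fixed index; this defines the limit parts. Two vertices
  of a limit part are eventually joined by a chordless path inside the approximating part, and
  since only finitely many chordless paths are available, one of them lies in the limit part.
  For each index, normalised near-minimisers of the Neumann energies are uniformly bounded
  by the sup-norm inequality (i), so a subsequence converges pointwise; because \<open>\<nu>(V)\<close> is finite, dominated
  convergence preserves the norm and the mean value (so no limit part is empty or a singleton), and
  the form is lower semicontinuous because the Neumann extensions converge pointwise.\<close>

section \<open>Infinite sums\<close>

text \<open>The parts, and with them the edge sets and the normalising sums of the Neumann
  extension, change along the sequence. Everything is therefore moved to index sets that stay fixed:
  a partition becomes a labelling of V by indices in \<open>{1..k}\<close>, functions are extended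
  by zero to V, and sums over boundary neighbours become sums over all neighbours with an indicator.
  Bounded labels on a countable set converge pointwise along a diagonal subsequence, and convergent
  integers are eventually constant. The majorants for dominated convergence are then multiples of
  the vertex weights, or of the edge weights at one vertex. The constant in (i) is common to all
  connected vertex sets, so one sup bound serves all parts of the sequence. Only the form itself has
  no majorant; energy may be lost in the limit, but an upper bound suffices. Condition (ii) prevents
  the paths that connect two fixed vertices inside a part from escaping to infinity.\<close>

lemma summable_on_if_infsum_ennreal_finite:
  fixes f :: "'a \<Rightarrow> real"
  assumes nn: "\<And>x. x \<in> A \<Longrightarrow> 0 \<le> f x" and fin: "(\<Sum>\<^sub>\<infinity>x\<in>A. ennreal (f x)) < \<infinity>"
  shows "f summable_on A"
proof (rule nonneg_bdd_above_summable_on)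
  show "bdd_above (sum f ` {F. F \<subseteq> A \<and> finite F})"
  proof (rule bdd_aboveI2)
    fix F assume "F \<in> {F. F \<subseteq> A \<and> finite F}"
    then have F: "F \<subseteq> A" "finite F" by auto
    have "ennreal (sum f F) = (\<Sum>x\<in>F. ennreal (f x))"
      using F nn by (intro sum_ennreal[symmetric]) auto
    also have "\<dots> = (\<Sum>\<^sub>\<infinity>x\<in>F. ennreal (f x))" using F by simp
    also have "\<dots> \<le> (\<Sum>\<^sub>\<infinity>x\<in>A. ennreal (f x))"
      using F by (intro infsum_mono_neutral nonneg_summable_on_complete) auto
    finally have "ennreal (sum f F) \<le> (\<Sum>\<^sub>\<infinity>x\<in>A. ennreal (f x))" .
    then show "sum f F \<le> enn2real (\<Sum>\<^sub>\<infinity>x\<in>A. ennreal (f x))"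
      using fin by (metis enn2real_mono enn2real_ennreal nn F(1) infinity_ennreal_def subsetD sum_nonneg)
  qed
qed (use nn in auto)

lemma infsum_ennreal:
  fixes f :: "'a \<Rightarrow> real"
  assumes "f summable_on A" "\<And>x. x \<in> A \<Longrightarrow> 0 \<le> f x"
  shows "(\<Sum>\<^sub>\<infinity>x\<in>A. ennreal (f x)) = ennreal (infsum f A)"
proof -
  have "ennreal (infsum f A) = (SUP F\<in>{F. finite F \<and> F \<subseteq> A}. ennreal (sum f F))"
    using assms by (rule infsum_nonneg_is_SUPREMUM_ennreal)
  also have "\<dots> = (SUP F\<in>{F. finite F \<and> F \<subseteq> A}. \<Sum>x\<in>F. ennreal (f x))"
    using assms(2) by (intro SUP_cong refl sum_ennreal[symmetric]) auto
  also have "\<dots> = (\<Sum>\<^sub>\<infinity>x\<in>A. ennreal (f x))"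
    by (rule nonneg_infsum_complete[symmetric]) auto
  finally show ?thesis by simp
qed

text \<open>Lebesgue's theorem for the counting measure: below a summable majorant every family is
  absolutely summable, so \<open>infsum\<close> is the integral over
  \<open>count_space A\<close>.\<close>

lemma infsum_tendsto_dominated:
  fixes f :: "nat \<Rightarrow> 'a \<Rightarrow> 'b::{banach,second_countable_topology}"
  assumes w: "w summable_on A" and le: "\<And>n x. x \<in> A \<Longrightarrow> norm (f n x) \<le> w x"
    and lim: "\<And>x. x \<in> A \<Longrightarrow> (\<lambda>n. f n x) \<longlonglongrightarrow> g x"
  shows "(\<lambda>n. infsum (f n) A) \<longlonglongrightarrow> infsum g A"
proof -
  have gle: "norm (g x) \<le> w x" if "x \<in> A" for x
    using le[OF that] by (intro LIMSEQ_le_const2[OF tendsto_norm[OF lim[OF that]]]) auto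
  have nn: "w x \<ge> 0" if "x \<in> A" for x using le[OF that] norm_ge_zero order_trans by blast
  have int: "integrable (count_space A) w"
    using w nn abs_summable_equivalent[of w A]
    by (auto simp: Infinite_Set_Sum.abs_summable_on_def cong: summable_on_cong)
  have conv: "integral\<^sup>L (count_space A) h = infsum h A"
    if "\<And>x. x \<in> A \<Longrightarrow> norm (h x) \<le> w x" for h :: "'a \<Rightarrow> 'b"
  proof -
    have "integrable (count_space A) h"
      using int by (rule Bochner_Integration.integrable_bound) (use that nn in \<open>auto simp: AE_count_space\<close>)
    then show ?thesis
      by (metis Infinite_Set_Sum.abs_summable_on_def infsetsum_infsum infsetsum_def)
  qed
  have "(\<lambda>n. integral\<^sup>L (count_space A) (f n)) \<longlonglongrightarrow> integral\<^sup>L (count_space A) g"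
    by (rule integral_dominated_convergence[OF _ _ int]) (use le lim in \<open>auto simp: AE_count_space\<close>)
  moreover have "integral\<^sup>L (count_space A) (f n) = infsum (f n) A" for n
    using le by (rule conv)
  moreover have "integral\<^sup>L (count_space A) g = infsum g A"
    using gle by (rule conv)
  ultimately show ?thesis by simp
qed

section \<open>Connected vertex sets\<close>

text \<open>Walks replace paths here: they compose and reverse freely, whereas gluing two paths may
  repeat vertices.\<close>

definition adjacent_within :: "'a wgraph \<Rightarrow> 'a set \<Rightarrow> 'a \<Rightarrow> 'a \<Rightarrow> bool" where
  "adjacent_within G S v w \<longleftrightarrow> v \<in> S \<and> w \<in> S \<and> adjacent G v w"

lemma adjacent_sym: "adjacent G v w \<longleftrightarrow> adjacent G w v"
  by (simp add: adjacent_def insert_commute)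

lemma adjacent_within_rtranclp_sym:
  "(adjacent_within G S)\<^sup>*\<^sup>* v w \<Longrightarrow> (adjacent_within G S)\<^sup>*\<^sup>* w v"
  by (rule sympD[OF symp_rtranclp]) (auto simp: symp_def adjacent_within_def adjacent_sym)

lemma graph_path_imp_rtranclp:
  assumes "graph_path G v w xs" "set xs \<subseteq> S"
  shows "(adjacent_within G S)\<^sup>*\<^sup>* v w"
proof -
  have "(adjacent_within G S)\<^sup>*\<^sup>* (hd xs) (last xs)"
    if "successively (adjacent G) xs" "xs \<noteq> []" "set xs \<subseteq> S" for xs
    using that
  proof (induction xs rule: induct_list012)
    case (3 x y zs)
    then have "adjacent_within G S x y" by (simp add: adjacent_within_def)
    moreover have "(adjacent_within G S)\<^sup>*\<^sup>* y (last (y # zs))" using 3 by simp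
    ultimately show ?case by (auto intro: converse_rtranclp_into_rtranclp)
  qed auto
  then show ?thesis using assms by (auto simp: graph_path_def)
qed

lemma rtranclp_imp_graph_path:
  assumes "(adjacent_within G S)\<^sup>*\<^sup>* v w" "v \<in> S" "S \<subseteq> verts G"
  shows "\<exists>xs. graph_path G v w xs \<and> set xs \<subseteq> S"
  using assms(1)
proof (induction rule: rtranclp_induct)
  case base
  show ?case using assms by (intro exI[of _ "[v]"]) (auto simp: graph_path_def)
next
  case (step y z)
  then obtain xs where xs: "graph_path G v y xs" "set xs \<subseteq> S" by blast
  show ?case
  proof (cases "z \<in> set xs")
    case True
    \<comment> \<open>A walk that returns to its own path is cut back there, which keeps the
      vertices distinct.\<close>
    then obtain as bs where ab: "xs = (as @ [z]) @ bs" by (metis append.assoc append_Cons append_Nil split_list)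
    have "graph_path G v z (as @ [z])"
      using xs unfolding graph_path_def ab successively_append_iff[of _ "as @ [z]" bs]
      by (auto simp: hd_append split: if_splits)
    then show ?thesis using xs ab by (intro exI[of _ "as @ [z]"]) auto
  next
    case False
    have "graph_path G v z (xs @ [z])"
      using xs False step(2) assms(3)
      by (auto simp: graph_path_def successively_append_iff adjacent_within_def)
    then show ?thesis using xs step(2) by (intro exI[of _ "xs @ [z]"]) (auto simp: adjacent_within_def)
  qed
qed

lemma induces_connected_iff_rtranclp:
  "induces_connected G S \<longleftrightarrow>
     S \<noteq> {} \<and> S \<subseteq> verts G \<and> (\<forall>v\<in>S. \<forall>w\<in>S. (adjacent_within G S)\<^sup>*\<^sup>* v w)"
  unfolding induces_connected_def
  by (meson graph_path_imp_rtranclp rtranclp_imp_graph_path)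

text \<open>The piece split off is a component of \<open>S - {v}\<close>; all other components remain attached to \<open>v\<close>.\<close>

lemma induces_connected_split:
  assumes S: "induces_connected G S" and v: "v \<in> S" "w \<in> S" "v \<noteq> w"
  obtains C where "C \<subseteq> S" "induces_connected G C" "induces_connected G (S - C)"
proof
  let ?R = "adjacent_within G"
  define C where "C = {u. (?R (S - {v}))\<^sup>*\<^sup>* w u}"
  have CS: "C \<subseteq> S - {v}"
  proof
    fix u assume "u \<in> C"
    then have "(?R (S - {v}))\<^sup>*\<^sup>* w u" by (simp add: C_def)
    then show "u \<in> S - {v}" by (cases rule: rtranclp.cases) (use v in \<open>auto simp: adjacent_within_def\<close>)
  qed
  show "C \<subseteq> S" using CS by blast
  have SV: "S \<subseteq> verts G" using S by (simp add: induces_connected_iff_rtranclp)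
  have wC: "(?R C)\<^sup>*\<^sup>* w u" if "u \<in> C" for u
  proof -
    have "(?R (S - {v}))\<^sup>*\<^sup>* w u" using that by (simp add: C_def)
    then show ?thesis
    proof (induction rule: rtranclp_induct)
      case (step y z)
      then have "y \<in> C" "z \<in> C" by (auto simp: C_def intro: rtranclp.rtrancl_into_rtrancl)
      with step show ?case
        by (auto simp: adjacent_within_def intro!: rtranclp.rtrancl_into_rtrancl[of _ w y z])
    qed simp
  qed
  show "induces_connected G C"
    unfolding induces_connected_iff_rtranclp
  proof (intro conjI ballI)
    show "C \<noteq> {}" by (auto simp: C_def)
    show "C \<subseteq> verts G" using CS SV by blast
    show "(?R C)\<^sup>*\<^sup>* x y" if "x \<in> C" "y \<in> C" for x y
      using that by (meson wC adjacent_within_rtranclp_sym rtranclp_trans)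
  qed
  have to_v: "(?R (S - C))\<^sup>*\<^sup>* u v" if "u \<in> S - C" for u
  proof -
    have "(?R S)\<^sup>*\<^sup>* u v" using S v that by (auto simp: induces_connected_iff_rtranclp)
    then show ?thesis using that
    proof (induction rule: converse_rtranclp_induct)
      case (step y z)
      show ?case
      proof (cases "y = v")
        case False
        \<comment> \<open>C absorbs every neighbour in \<open>S - {v}\<close> of its vertices, so a
          walk in S from outside C cannot enter C before it reaches \<open>v\<close>.\<close>
        have "z \<notin> C"
        proof
          assume z: "z \<in> C"
          then have "?R (S - {v}) z y"
            using step.hyps(1) False CS adjacent_sym[of G z y] by (auto simp: adjacent_within_def)
          then have "y \<in> C" using z by (auto simp: C_def intro: rtranclp.rtrancl_into_rtrancl)
          then show False using step by simp
        qed
        then show ?thesis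
          using step by (auto simp: adjacent_within_def intro!: converse_rtranclp_into_rtranclp[of _ y z v])
      qed simp
    qed simp
  qed
  show "induces_connected G (S - C)"
    unfolding induces_connected_iff_rtranclp
  proof (intro conjI ballI)
    show "S - C \<noteq> {}" using CS v by auto
    show "S - C \<subseteq> verts G" using SV by blast
    show "(?R (S - C))\<^sup>*\<^sup>* x y" if "x \<in> S - C" "y \<in> S - C" for x y
      using that by (meson to_v adjacent_within_rtranclp_sym rtranclp_trans)
  qed
qed

text \<open>One part is split at a time: while \<open>k\<close> is below the number of vertices, the
  pigeonhole principle yields a part with two distinct vertices. This supplies a witness when the
  optimal energy is infinite.\<close>

lemma connected_partitions_nonempty:
  assumes G: "induces_connected G (verts G)" and "1 \<le> k"
    and "finite (verts G) \<longrightarrow> k \<le> card (verts G)"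
  shows "connected_partitions G k \<noteq> {}"
  using assms(2,3)
proof (induction k rule: nat_induct_at_least)
  case base
  have "(\<lambda>_. verts G) \<in> connected_partitions G 1"
    using G by (auto simp: connected_partitions_def disjoint_family_on_def induces_connected_def)
  then show ?case by blast
next
  case (Suc k)
  then have "connected_partitions G k \<noteq> {}" by auto
  then obtain P where P: "P \<in> connected_partitions G k" by blast
  then have disj: "disjoint_family_on P {1..k}" and un: "(\<Union>j\<in>{1..k}. P j) = verts G"
    and con: "\<And>j. j \<in> {1..k} \<Longrightarrow> induces_connected G (P j)" by (auto simp: connected_partitions_def)
  have "\<exists>j\<in>{1..k}. \<exists>v w. v \<in> P j \<and> w \<in> P j \<and> v \<noteq> w"
  proof (rule ccontr)
    assume "\<not> ?thesis"
    then have single: "\<forall>j\<in>{1..k}. \<exists>v. P j \<subseteq> {v}" by blast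
    then obtain c where c: "\<And>j. j \<in> {1..k} \<Longrightarrow> P j \<subseteq> {c j}" by metis
    then have "verts G \<subseteq> c ` {1..k}" using un by blast
    then have "finite (verts G)" "card (verts G) \<le> k"
      using finite_subset surj_card_le[of "{1..k}" "verts G" c] by auto
    then show False using Suc.prems by simp
  qed
  then obtain j v w where j: "j \<in> {1..k}" and vw: "v \<in> P j" "w \<in> P j" "v \<noteq> w" by blast
  obtain C where C: "C \<subseteq> P j" "induces_connected G C" "induces_connected G (P j - C)"
    using induces_connected_split[OF con[OF j] vw] by metis
  define P' where "P' = P(j := C, Suc k := P j - C)"
  have P'j: "P' j = C" "P' (Suc k) = P j - C" "\<And>i. i \<noteq> j \<Longrightarrow> i \<noteq> Suc k \<Longrightarrow> P' i = P i"
    using j by (auto simp: P'_def)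
  have conn: "induces_connected G (P' i)" if "i \<in> {1..Suc k}" for i
    using that C con P'j by (metis atLeastAtMost_iff le_SucE)
  \<comment> \<open>Each new part lies in its parent, and the index \<open>Suc k\<close> descends
    from \<open>j\<close>. Disjointness is inherited for distinct parents; the two siblings are C
    and its complement in \<open>P j\<close>.\<close>
  have sub: "P' i \<subseteq> P (if i = Suc k then j else i)" for i
    using C P'j by (cases "i = j"; cases "i = Suc k") auto
  have "P' \<in> connected_partitions G (Suc k)"
    unfolding connected_partitions_def mem_Collect_eq
  proof (intro conjI ballI)
    show "P' i \<noteq> {}" if "i \<in> {1..Suc k}" for i
      using conn[OF that] by (simp add: induces_connected_def)
    show "disjoint_family_on P' {1..Suc k}"
      unfolding disjoint_family_on_def
    proof (intro ballI impI)
      fix i i' assume i: "i \<in> {1..Suc k}" "i' \<in> {1..Suc k}" "i \<noteq> i'"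
      let ?t = "\<lambda>i. if i = Suc k then j else i"
      show "P' i \<inter> P' i' = {}"
      proof (cases "?t i = ?t i'")
        case True
        then have "{i, i'} = {j, Suc k}" using i by (auto split: if_splits)
        then show ?thesis using P'j by (auto simp: doubleton_eq_iff)
      next
        case False
        then have "P (?t i) \<inter> P (?t i') = {}"
          using i j by (intro disjoint_family_onD[OF disj]) auto
        then show ?thesis using sub by blast
      qed
    qed
    have "(\<Union>i\<in>{1..Suc k}. P' i) = (\<Union>i\<in>{1..k}. P i)"
    proof
      show "(\<Union>i\<in>{1..Suc k}. P' i) \<subseteq> (\<Union>i\<in>{1..k}. P i)"
        using sub j by (force split: if_splits)
      show "(\<Union>i\<in>{1..k}. P i) \<subseteq> (\<Union>i\<in>{1..Suc k}. P' i)"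
      proof
        fix x assume "x \<in> (\<Union>i\<in>{1..k}. P i)"
        then obtain i where i: "i \<in> {1..k}" "x \<in> P i" by blast
        show "x \<in> (\<Union>i\<in>{1..Suc k}. P' i)"
        proof (cases "i = j")
          case True
          then have "x \<in> P' j \<or> x \<in> P' (Suc k)" using i P'j by auto
          then show ?thesis using j by auto
        next
          case False
          then have "x \<in> P' i" using i P'j by auto
          then show ?thesis using i by auto
        qed
      qed
    qed
    then show "(\<Union>i\<in>{1..Suc k}. P' i) = verts G" using un by simp
  qed (rule conn)
  then show ?case by blast
qed

text \<open>A chord would shorten a path of minimal length.\<close>

lemma induces_connected_non_contractible_path:
  assumes S: "induces_connected G S" and v: "v \<in> S" "w \<in> S"
  obtains xs where "graph_path G v w xs" "set xs \<subseteq> S" "non_contractible G xs"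
proof -
  define xs where "xs = arg_min length (\<lambda>xs. graph_path G v w xs \<and> set xs \<subseteq> S)"
  have ex: "\<exists>xs. graph_path G v w xs \<and> set xs \<subseteq> S" using S v by (auto simp: induces_connected_def)
  then have xs: "graph_path G v w xs" "set xs \<subseteq> S"
    using arg_min_natI[of "\<lambda>xs. graph_path G v w xs \<and> set xs \<subseteq> S" _ length] by (auto simp: xs_def)
  have min: "length xs \<le> length ys" if "graph_path G v w ys" "set ys \<subseteq> S" for ys
    unfolding xs_def using that by (intro arg_min_nat_le) auto
  have "non_contractible G xs"
    unfolding non_contractible_def
  proof (intro allI impI, elim conjE, rule ccontr)
    fix i j assume ij: "i < j" "j < length xs" "adjacent G (xs ! i) (xs ! j)" "j \<noteq> Suc i"
    \<comment> \<open>The chord bridges the gap, and since \<open>j\<close> exceeds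
      \<open>Suc i\<close> at least one vertex is dropped.\<close>
    define ys where "ys = take (Suc i) xs @ drop j xs"
    have set: "set ys \<subseteq> set xs" by (auto simp: ys_def dest: in_set_takeD in_set_dropD)
    have ne: "xs \<noteq> []" "drop j xs \<noteq> []" "take (Suc i) xs \<noteq> []" using ij by auto
    have "distinct ys"
      using xs ij by (auto simp: ys_def graph_path_def set_take_disj_set_drop_if_distinct)
    moreover have "successively (adjacent G) ys"
    proof -
      have s: "successively (adjacent G) xs" using xs by (simp add: graph_path_def)
      have "successively (adjacent G) (take n xs)" "successively (adjacent G) (drop n xs)" for n
        using s successively_append_iff[of "adjacent G" "take n xs" "drop n xs"] by auto
      moreover have "last (take (Suc i) xs) = xs ! i" using ij by (simp add: take_Suc_conv_app_nth)
      moreover have "hd (drop j xs) = xs ! j" using ij by (simp add: hd_drop_conv_nth)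
      ultimately show ?thesis using ij by (simp add: ys_def successively_append_iff)
    qed
    ultimately have "graph_path G v w ys"
      using xs ne set ij unfolding graph_path_def by (auto simp: ys_def hd_append)
    then have "length xs \<le> length ys" using set xs by (intro min) auto
    then show False using ij by (simp add: ys_def)
  qed
  then show thesis using that xs by blast
qed

lemma induces_connected_limit:
  assumes con: "\<And>n. induces_connected G (S n)"
    and ev: "\<And>v. v \<in> verts G \<Longrightarrow> \<forall>\<^sub>F n in sequentially. v \<in> S n \<longleftrightarrow> v \<in> S'"
    and S': "S' \<noteq> {}" "S' \<subseteq> verts G"
    and fin: "\<forall>v\<in>verts G. \<forall>w\<in>verts G. v \<noteq> w \<longrightarrow>
          finite {xs. graph_path G v w xs \<and> non_contractible G xs}"
  shows "induces_connected G S'"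
  unfolding induces_connected_def
proof (intro conjI ballI)
  fix v w assume vw: "v \<in> S'" "w \<in> S'"
  show "\<exists>xs. graph_path G v w xs \<and> set xs \<subseteq> S'"
  proof (cases "v = w")
    case True
    then show ?thesis using vw S' by (intro exI[of _ "[v]"]) (auto simp: graph_path_def)
  next
    case False
    define X where "X = {xs. graph_path G v w xs \<and> non_contractible G xs}"
    have "finite X" using fin vw S' False by (auto simp: X_def)
    \<comment> \<open>All these paths together visit finitely many vertices, so one \<open>n\<close>
      settles membership for every candidate path before a path is chosen.\<close>
    then have "\<forall>\<^sub>F n in sequentially. \<forall>x\<in>(\<Union>xs\<in>X. set xs) \<union> {v, w}. x \<in> S n \<longleftrightarrow> x \<in> S'"
      using vw S' by (intro eventually_ball_finite ballI ev) (auto simp: X_def graph_path_def)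
    then obtain n where n: "\<And>x. x \<in> (\<Union>xs\<in>X. set xs) \<union> {v, w} \<Longrightarrow> x \<in> S n \<longleftrightarrow> x \<in> S'"
      by (auto simp: eventually_sequentially)
    then have "v \<in> S n" "w \<in> S n" using vw by auto
    then obtain xs where "graph_path G v w xs" "set xs \<subseteq> S n" "non_contractible G xs"
      using induces_connected_non_contractible_path[OF con] by metis
    then show ?thesis using n by (intro exI[of _ xs]) (auto simp: X_def)
  qed
qed (use S' in auto)

section \<open>The Neumann form\<close>

lemma edge_diff_sq_doubleton: "edge_diff_sq f {v, w} = (cmod (f v - f w))\<^sup>2"
  unfolding edge_diff_sq_def
  by (rule the_equality) (auto simp: doubleton_eq_iff norm_minus_commute)

lemma edge_doubleton:
  assumes "weighted_graph G" "e \<in> edges G"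
  obtains v w where "e = {v, w}" "v \<noteq> w" "v \<in> verts G" "w \<in> verts G"
  using assms unfolding weighted_graph_def card_2_iff by (metis insert_subset)

lemma edge_diff_sq_nonneg:
  assumes "weighted_graph G" "e \<in> edges G"
  shows "0 \<le> edge_diff_sq f e"
  using assms by (elim edge_doubleton) (auto simp: edge_diff_sq_doubleton)

lemma edge_term_nonneg:
  assumes "weighted_graph G" "e \<in> inner_edges G S \<union> edge_boundary G S"
  shows "0 \<le> eweight G e * edge_diff_sq f e"
proof -
  have "e \<in> edges G" using assms(2) by (auto simp: inner_edges_def edge_boundary_def)
  then show ?thesis
    using assms(1) edge_diff_sq_nonneg[of G e f] by (simp add: weighted_graph_def less_imp_le)
qed

text \<open>The graph condition sums over incident edges, the extension over neighbours;
  \<open>w\<close> corresponds bijectively to the edge \<open>{v, w}\<close>.\<close>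

lemma eweight_summable:
  assumes "weighted_graph G" "v \<in> verts G"
  shows "(\<lambda>w. eweight G {v, w}) summable_on {w. adjacent G v w}"
proof -
  have inj: "inj_on (\<lambda>w. {v, w}) {w. adjacent G v w}" by (auto simp: inj_on_def doubleton_eq_iff)
  have "(\<lambda>w. {v, w}) ` {w. adjacent G v w} = {e \<in> edges G. v \<in> e}"
  proof
    show "{e \<in> edges G. v \<in> e} \<subseteq> (\<lambda>w. {v, w}) ` {w. adjacent G v w}"
    proof
      fix e assume e: "e \<in> {e \<in> edges G. v \<in> e}"
      then obtain x y where "e = {x, y}" using edge_doubleton[OF assms(1)] by blast
      with e show "e \<in> (\<lambda>w. {v, w}) ` {w. adjacent G v w}"
        by (auto simp: adjacent_def insert_commute)
    qed
  qed (auto simp: adjacent_def)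
  moreover have "eweight G summable_on {e \<in> edges G. v \<in> e}"
    by (rule summable_on_if_infsum_ennreal_finite) (use assms in \<open>auto simp: weighted_graph_def less_imp_le\<close>)
  ultimately show ?thesis using summable_on_reindex[OF inj, of "eweight G"] by (simp add: o_def)
qed

lemma vweight_summable:
  assumes "weighted_graph G" "vmeasure G (verts G) < \<infinity>"
  shows "vweight G summable_on verts G"
  by (rule summable_on_if_infsum_ennreal_finite)
    (use assms in \<open>auto simp: weighted_graph_def vmeasure_def less_imp_le\<close>)

lemma boundary_neighbours_eq:
  assumes "S \<subseteq> verts G" "v \<in> verts G - S"
  shows "boundary_neighbours G S v = {w \<in> S. adjacent G v w}"
  using assms by (auto simp: boundary_neighbours_def edge_boundary_def adjacent_def)

text \<open>Both sums now run over all neighbours of \<open>v\<close>. Only the summands depend on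
  \<open>S\<close>, as dominated convergence for varying \<open>S\<close> requires.\<close>

lemma neumann_ext_boundary:
  assumes "S \<subseteq> verts G" "v \<in> vertex_boundary G S"
  shows "neumann_ext G S g v =
     (\<Sum>\<^sub>\<infinity>w\<in>{w. adjacent G v w}. complex_of_real (eweight G {v, w}) * (if w \<in> S then g w else 0)) /
     complex_of_real (\<Sum>\<^sub>\<infinity>w\<in>{w. adjacent G v w}. eweight G {v, w} * indicator S w)"
proof -
  have v: "v \<in> verts G - S" using assms by (auto simp: vertex_boundary_def)
  have "(\<Sum>\<^sub>\<infinity>w\<in>{w \<in> S. adjacent G v w}. complex_of_real (eweight G {v, w}) * g w) =
    (\<Sum>\<^sub>\<infinity>w\<in>{w. adjacent G v w}. complex_of_real (eweight G {v, w}) * (if w \<in> S then g w else 0))"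
    by (rule infsum_cong_neutral) auto
  moreover have "(\<Sum>\<^sub>\<infinity>w\<in>{w \<in> S. adjacent G v w}. eweight G {v, w}) =
    (\<Sum>\<^sub>\<infinity>w\<in>{w. adjacent G v w}. eweight G {v, w} * indicator S w)"
    by (rule infsum_cong_neutral) auto
  ultimately show ?thesis
    using v assms by (simp add: neumann_ext_def boundary_neighbours_eq)
qed

section \<open>Homogeneity and normalised competitors\<close>

lemma neumann_ext_scale: "neumann_ext G S (\<lambda>v. c * g v) v = c * neumann_ext G S g v"
proof -
  have "(\<Sum>\<^sub>\<infinity>w\<in>boundary_neighbours G S v. complex_of_real (eweight G {v, w}) * (c * g w)) =
     c * (\<Sum>\<^sub>\<infinity>w\<in>boundary_neighbours G S v. complex_of_real (eweight G {v, w}) * g w)"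
    by (simp add: mult.left_commute infsum_cmult_right')
  then show ?thesis by (simp add: neumann_ext_def)
qed

text \<open>Multiplication on \<^typ>\<open>ennreal\<close> is not continuous, so \<open>infsum_cmult_right\<close> does not apply.\<close>

lemma ennreal_infsum_scale:
  fixes f :: "'a \<Rightarrow> real"
  assumes "\<And>x. x \<in> A \<Longrightarrow> 0 \<le> f x" and fin: "(\<Sum>\<^sub>\<infinity>x\<in>A. ennreal (f x)) < \<infinity>" and c: "0 \<le> c"
  shows "(\<Sum>\<^sub>\<infinity>x\<in>A. ennreal (c * f x)) = ennreal c * (\<Sum>\<^sub>\<infinity>x\<in>A. ennreal (f x))"
proof -
  have s: "f summable_on A" using assms(1) fin by (rule summable_on_if_infsum_ennreal_finite)
  have "(\<Sum>\<^sub>\<infinity>x\<in>A. ennreal (c * f x)) = ennreal (\<Sum>\<^sub>\<infinity>x\<in>A. c * f x)"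
    using assms s by (intro infsum_ennreal summable_on_cmult_right) auto
  also have "\<dots> = ennreal c * ennreal (infsum f A)"
    using assms by (simp add: infsum_cmult_right' ennreal_mult infsum_nonneg)
  finally show ?thesis using infsum_ennreal[OF s assms(1)] by simp
qed

lemma neumann_form_scale:
  assumes G: "weighted_graph G" and fin: "neumann_form G S g < \<infinity>"
  shows "neumann_form G S (\<lambda>v. c * g v) = ennreal ((cmod c)\<^sup>2) * neumann_form G S g"
proof -
  have "edge_diff_sq (neumann_ext G S (\<lambda>v. c * g v)) e = (cmod c)\<^sup>2 * edge_diff_sq (neumann_ext G S g) e"
    if e: "e \<in> edges G" for e
  proof -
    obtain v w where "e = {v, w}" using edge_doubleton[OF G e] by blast
    then show ?thesis
      by (simp add: edge_diff_sq_doubleton neumann_ext_scale norm_mult power_mult_distrib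
          flip: right_diff_distrib)
  qed
  then have "neumann_form G S (\<lambda>v. c * g v) =
    (\<Sum>\<^sub>\<infinity>e\<in>inner_edges G S \<union> edge_boundary G S.
        ennreal ((cmod c)\<^sup>2 * (eweight G e * edge_diff_sq (neumann_ext G S g) e)))"
    unfolding neumann_form_def
    by (intro infsum_cong) (auto simp: inner_edges_def edge_boundary_def mult.left_commute)
  also have "\<dots> = ennreal ((cmod c)\<^sup>2) * neumann_form G S g"
    unfolding neumann_form_def
    by (rule ennreal_infsum_scale) (use fin edge_term_nonneg[OF G] in \<open>auto simp: neumann_form_def\<close>)
  finally show ?thesis .
qed

lemma l2_norm_sq_scale:
  assumes G: "weighted_graph G" and S: "S \<subseteq> verts G" and fin: "l2_norm_sq G S g < \<infinity>"
  shows "l2_norm_sq G S (\<lambda>v. c * g v) = ennreal ((cmod c)\<^sup>2) * l2_norm_sq G S g"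
proof -
  have "l2_norm_sq G S (\<lambda>v. c * g v) =
     (\<Sum>\<^sub>\<infinity>v\<in>S. ennreal ((cmod c)\<^sup>2 * (vweight G v * (cmod (g v))\<^sup>2)))"
    unfolding l2_norm_sq_def
    by (intro infsum_cong) (simp add: norm_mult power_mult_distrib mult.left_commute)
  also have "\<dots> = ennreal ((cmod c)\<^sup>2) * l2_norm_sq G S g"
    unfolding l2_norm_sq_def
    by (rule ennreal_infsum_scale)
      (use fin G S in \<open>auto simp: l2_norm_sq_def weighted_graph_def less_imp_le subset_iff\<close>)
  finally show ?thesis .
qed

lemma l2_norm_sq_pos:
  assumes G: "weighted_graph G" and S: "S \<subseteq> verts G" and v: "v \<in> S" "g v \<noteq> 0"
  shows "0 < l2_norm_sq G S g"
proof -
  have "0 < vweight G v * (cmod (g v))\<^sup>2"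
    using G S v by (auto simp: weighted_graph_def)
  then have "0 < ennreal (vweight G v * (cmod (g v))\<^sup>2)" by simp
  also have "\<dots> = (\<Sum>\<^sub>\<infinity>v\<in>{v}. ennreal (vweight G v * (cmod (g v))\<^sup>2))" by simp
  also have "\<dots> \<le> l2_norm_sq G S g"
    unfolding l2_norm_sq_def
    using v by (intro infsum_mono_neutral nonneg_summable_on_complete) auto
  finally show ?thesis .
qed

lemma neumann_domain_scale:
  assumes G: "weighted_graph G" and S: "S \<subseteq> verts G" and g: "g \<in> neumann_domain G S"
  shows "(\<lambda>v. c * g v) \<in> neumann_domain G S"
  unfolding neumann_domain_def mem_Collect_eq
proof (intro conjI ballI)
  have fin: "l2_norm_sq G S g < \<infinity>" "neumann_form G S g < \<infinity>"
    using g by (auto simp: neumann_domain_def)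
  show "l2_norm_sq G S (\<lambda>v. c * g v) < \<infinity>"
    using fin by (simp add: l2_norm_sq_scale[OF G S] ennreal_mult_less_top)
  show "neumann_form G S (\<lambda>v. c * g v) < \<infinity>"
    using fin by (simp add: neumann_form_scale[OF G] ennreal_mult_less_top)
  fix v assume "v \<in> vertex_boundary G S"
  then have "(\<lambda>w. cmod (complex_of_real (eweight G {v, w}) * g w)) summable_on boundary_neighbours G S v"
    using g by (auto simp: neumann_domain_def)
  from summable_on_cmult_right[OF this, of "cmod c"]
  show "(\<lambda>w. cmod (complex_of_real (eweight G {v, w}) * (c * g w))) summable_on boundary_neighbours G S v"
    by (simp add: norm_mult mult.left_commute)
qed

text \<open>A strict bound on the infimum yields a competitor below it, whether or not the infimum
  is attained, and scaling to norm 1 turns its quotient into its form value. The finite bound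
  excludes singletons, whose energy is infinite by convention.\<close>

lemma normalised_near_minimiser:
  assumes G: "weighted_graph G" and S: "S \<subseteq> verts G" and less: "neumann_energy G S < ennreal a"
  obtains f where "f \<in> neumann_domain G S" "mean_zero G S f" "l2_norm_sq G S f = 1"
    "neumann_form G S f \<le> ennreal a"
proof -
  have "card S \<noteq> 1"
  proof
    assume "card S = 1"
    then have "neumann_energy G S = \<infinity>" unfolding neumann_energy_def by (rule if_P)
    then show False using less by simp
  qed
  then have "Inf {neumann_form G S g / l2_norm_sq G S g | g.
      g \<in> neumann_domain G S \<and> (\<exists>v\<in>S. g v \<noteq> 0) \<and> mean_zero G S g} < ennreal a"
    using less unfolding neumann_energy_def by (simp only: if_False)
  then obtain g where g: "g \<in> neumann_domain G S" "\<exists>v\<in>S. g v \<noteq> 0" "mean_zero G S g"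
    and q: "neumann_form G S g / l2_norm_sq G S g < ennreal a"
    unfolding Inf_less_iff by blast
  have fin: "l2_norm_sq G S g < \<infinity>" "neumann_form G S g < \<infinity>"
    using g by (auto simp: neumann_domain_def)
  obtain N where N: "l2_norm_sq G S g = ennreal N" "0 < N"
    using g(2) l2_norm_sq_pos[OF G S, of _ g] fin by (cases "l2_norm_sq G S g") auto
  obtain Q where Q: "neumann_form G S g = ennreal Q" "0 \<le> Q"
    using fin by (cases "neumann_form G S g") auto
  \<comment> \<open>Norm squared and form are both quadratic, so this factor divides each of them by
    \<open>N\<close>.\<close>
  define c where "c = complex_of_real (1 / sqrt N)"
  have c: "(cmod c)\<^sup>2 = 1 / N" using N by (simp add: c_def power_divide norm_divide)
  show thesis
  proof
    show "(\<lambda>v. c * g v) \<in> neumann_domain G S" using neumann_domain_scale[OF G S g(1)] .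
    show "mean_zero G S (\<lambda>v. c * g v)"
      using has_sum_cmult_right[OF g(3)[unfolded mean_zero_def], of c]
      by (simp add: mean_zero_def mult.left_commute)
    show "l2_norm_sq G S (\<lambda>v. c * g v) = 1"
    proof -
      have "l2_norm_sq G S (\<lambda>v. c * g v) = ennreal (1 / N) * ennreal N"
        by (simp only: l2_norm_sq_scale[OF G S fin(1)] c N)
      also have "\<dots> = ennreal (1 / N * N)" using N by (intro ennreal_mult[symmetric]) auto
      finally show ?thesis using N by simp
    qed
    show "neumann_form G S (\<lambda>v. c * g v) \<le> ennreal a"
    proof -
      have "neumann_form G S (\<lambda>v. c * g v) = ennreal (1 / N) * ennreal Q"
        by (simp only: neumann_form_scale[OF G fin(2)] c Q)
      also have "\<dots> = ennreal (1 / N * Q)" using N Q by (intro ennreal_mult[symmetric]) auto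
      also have "\<dots> = neumann_form G S g / l2_norm_sq G S g" using N Q by (simp add: divide_ennreal)
      finally show ?thesis using q by simp
    qed
  qed
qed

section \<open>Passage to the limit in the Neumann form and energy\<close>

text \<open>Dominated convergence in numerator and denominator, with the edge weights at
  \<open>v\<close>, times \<open>B\<close> for the numerator, as majorants. The claim is confined to
  \<open>S'\<close> and its boundary: elsewhere the extension for \<open>S'\<close> is 0 by default,
  while \<open>v\<close> may keep neighbours in every \<open>S n\<close> that escape to infinity. No
  edge of the form for \<open>S'\<close> meets such a vertex.\<close>

lemma neumann_ext_tendsto:
  fixes f :: "nat \<Rightarrow> 'a \<Rightarrow> complex"
  assumes G: "weighted_graph G" and S: "\<And>n. S n \<subseteq> verts G" "S' \<subseteq> verts G"
    and ev: "\<And>v. v \<in> verts G \<Longrightarrow> \<forall>\<^sub>F n in sequentially. v \<in> S n \<longleftrightarrow> v \<in> S'"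
    and bd: "\<And>n v. v \<in> S n \<Longrightarrow> cmod (f n v) \<le> B" and B: "0 \<le> B"
    and lim: "\<And>v. v \<in> S' \<Longrightarrow> (\<lambda>n. f n v) \<longlonglongrightarrow> g v"
    and v: "v \<in> S' \<union> vertex_boundary G S'"
  shows "(\<lambda>n. neumann_ext G (S n) (f n) v) \<longlonglongrightarrow> neumann_ext G S' g v"
proof (cases "v \<in> S'")
  case True
  then have "\<forall>\<^sub>F n in sequentially. v \<in> S n" using ev[of v] S by auto
  then have "\<forall>\<^sub>F n in sequentially. f n v = neumann_ext G (S n) (f n) v"
    by eventually_elim (simp add: neumann_ext_def)
  then show ?thesis
    using Lim_transform_eventually[OF lim[OF True]] True by (simp add: neumann_ext_def)
next
  case False
  then have vb: "v \<in> vertex_boundary G S'" using v by auto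
  then obtain u where vu: "v \<in> verts G" "u \<in> S'" "adjacent G v u"
    by (auto simp: vertex_boundary_def)
  let ?N = "{w. adjacent G v w}"
  have NV: "?N \<subseteq> verts G" using G by (auto simp: weighted_graph_def adjacent_def)
  have \<omega>: "0 < eweight G {v, w}" if "w \<in> ?N" for w
    using that G by (auto simp: weighted_graph_def adjacent_def)
  define num where "num n = (\<Sum>\<^sub>\<infinity>w\<in>?N. complex_of_real (eweight G {v, w}) * (if w \<in> S n then f n w else 0))" for n
  define num' where "num' = (\<Sum>\<^sub>\<infinity>w\<in>?N. complex_of_real (eweight G {v, w}) * (if w \<in> S' then g w else 0))"
  define den where "den n = (\<Sum>\<^sub>\<infinity>w\<in>?N. eweight G {v, w} * indicator (S n) w)" for n
  define den' where "den' = (\<Sum>\<^sub>\<infinity>w\<in>?N. eweight G {v, w} * indicator S' w)"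
  note sum\<omega> = eweight_summable[OF G vu(1)]
  have ind: "\<forall>\<^sub>F n in sequentially. w \<in> S n \<longleftrightarrow> w \<in> S'" if "w \<in> ?N" for w
    using ev that NV by blast
  have "num \<longlonglongrightarrow> num'"
    unfolding num_def num'_def
  proof (rule infsum_tendsto_dominated[where w = "\<lambda>w. eweight G {v, w} * B"])
    show "(\<lambda>w. eweight G {v, w} * B) summable_on ?N" by (rule summable_on_cmult_left[OF sum\<omega>])
    show "norm (complex_of_real (eweight G {v, w}) * (if w \<in> S n then f n w else 0)) \<le> eweight G {v, w} * B"
      if "w \<in> ?N" for n w
      using \<omega>[OF that] bd[of w n] B by (auto simp: norm_mult)
    show "(\<lambda>n. complex_of_real (eweight G {v, w}) * (if w \<in> S n then f n w else 0))
      \<longlonglongrightarrow> complex_of_real (eweight G {v, w}) * (if w \<in> S' then g w else 0)" if w: "w \<in> ?N" for w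
    proof (intro tendsto_mult tendsto_const)
      show "(\<lambda>n. if w \<in> S n then f n w else 0) \<longlonglongrightarrow> (if w \<in> S' then g w else 0)"
      proof (rule Lim_transform_eventually)
        show "\<forall>\<^sub>F n in sequentially. (if w \<in> S' then f n w else 0) = (if w \<in> S n then f n w else 0)"
          using ind[OF w] by eventually_elim auto
        show "(\<lambda>n. if w \<in> S' then f n w else 0) \<longlonglongrightarrow> (if w \<in> S' then g w else 0)"
          using lim by auto
      qed
    qed
  qed
  moreover have "den \<longlonglongrightarrow> den'"
    unfolding den_def den'_def
  proof (rule infsum_tendsto_dominated[OF sum\<omega>])
    show "norm (eweight G {v, w} * indicator (S n) w) \<le> eweight G {v, w}" if "w \<in> ?N" for n w
      using \<omega>[OF that] by (auto simp: indicator_def)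
    show "(\<lambda>n. eweight G {v, w} * indicator (S n) w) \<longlonglongrightarrow> eweight G {v, w} * indicator S' w"
      if w: "w \<in> ?N" for w
    proof (rule tendsto_eventually)
      show "\<forall>\<^sub>F n in sequentially. eweight G {v, w} * indicator (S n) w = eweight G {v, w} * indicator S' w"
        using ind[OF w] by eventually_elim (auto simp: indicator_def)
    qed
  qed
  \<comment> \<open>The neighbour \<open>u\<close> in \<open>S'\<close> alone makes the limiting
    denominator positive.\<close>
  moreover have "den' \<noteq> 0"
  proof -
    have "(\<lambda>w. eweight G {v, w} * indicator S' w) summable_on ?N"
      by (rule summable_on_comparison_test[OF sum\<omega>])
        (auto simp: indicator_def intro: less_imp_le[OF \<omega>])
    then have "(\<Sum>w\<in>{u}. eweight G {v, w} * indicator S' w) \<le> den'"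
      unfolding den'_def using vu
      by (intro finite_sum_le_infsum) (auto simp: indicator_def intro: less_imp_le[OF \<omega>])
    then show ?thesis using \<omega>[of u] vu by auto
  qed
  ultimately have "(\<lambda>n. num n / complex_of_real (den n)) \<longlonglongrightarrow> num' / complex_of_real den'"
    by (intro tendsto_intros) auto
  moreover have "\<forall>\<^sub>F n in sequentially. v \<in> S n \<longleftrightarrow> v \<in> S'" "\<forall>\<^sub>F n in sequentially. u \<in> S n \<longleftrightarrow> u \<in> S'"
    using ev[of v] ev[of u] vu S by blast+
  then have "\<forall>\<^sub>F n in sequentially. num n / complex_of_real (den n) = neumann_ext G (S n) (f n) v"
  proof eventually_elim
    case (elim n)
    \<comment> \<open>With \<open>v\<close> outside and \<open>u\<close> inside \<open>S n\<close>,
      the boundary formula applies to \<open>S n\<close> as well.\<close>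
    then have "v \<in> vertex_boundary G (S n)" using vu False by (auto simp: vertex_boundary_def)
    then show ?case using neumann_ext_boundary[OF S(1)] by (simp add: num_def den_def)
  qed
  ultimately show ?thesis
    using neumann_ext_boundary[OF S(2) vb, of g] Lim_transform_eventually
    by (fastforce simp: num'_def den'_def)
qed

text \<open>A Fatou argument: the form is the supremum of its finite partial sums, and on a finite
  set of edges every term converges.\<close>

lemma neumann_form_lower_semicontinuous:
  fixes f :: "nat \<Rightarrow> 'a \<Rightarrow> complex"
  assumes G: "weighted_graph G" and S: "\<And>n. S n \<subseteq> verts G" "S' \<subseteq> verts G"
    and ev: "\<And>v. v \<in> verts G \<Longrightarrow> \<forall>\<^sub>F n in sequentially. v \<in> S n \<longleftrightarrow> v \<in> S'"
    and bd: "\<And>n v. v \<in> S n \<Longrightarrow> cmod (f n v) \<le> B" and B: "0 \<le> B"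
    and lim: "\<And>v. v \<in> S' \<Longrightarrow> (\<lambda>n. f n v) \<longlonglongrightarrow> g v"
    and le: "\<And>n. neumann_form G (S n) (f n) \<le> b n" and b: "b \<longlonglongrightarrow> L"
  shows "neumann_form G S' g \<le> L"
  unfolding neumann_form_def
proof (rule infsum_le_finite_sums)
  fix F assume F: "finite F" "F \<subseteq> inner_edges G S' \<union> edge_boundary G S'"
  let ?t = "\<lambda>S g e. ennreal (eweight G e * edge_diff_sq (neumann_ext G S g) e)"
  have evF: "\<forall>\<^sub>F n in sequentially. \<forall>e\<in>F. e \<in> inner_edges G (S n) \<union> edge_boundary G (S n)"
  proof (intro eventually_ball_finite[OF F(1)] ballI)
    fix e assume e: "e \<in> F"
    then have eG: "e \<in> edges G" using F by (auto simp: inner_edges_def edge_boundary_def)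
    then obtain v w where vw: "e = {v, w}" "v \<in> verts G" "w \<in> verts G" using edge_doubleton[OF G] by metis
    \<comment> \<open>Whether an edge counts depends on its two endpoints alone, and both are
      eventually settled.\<close>
    from ev[OF vw(2)] ev[OF vw(3)]
    show "\<forall>\<^sub>F n in sequentially. e \<in> inner_edges G (S n) \<union> edge_boundary G (S n)"
    proof eventually_elim
      case (elim n)
      have "e \<in> inner_edges G S' \<union> edge_boundary G S'" using e F by auto
      then have "v \<in> S' \<or> w \<in> S'" using vw by (auto simp: inner_edges_def edge_boundary_def doubleton_eq_iff)
      then show ?case using elim vw eG S unfolding inner_edges_def edge_boundary_def
        by (cases "v \<in> S'"; cases "w \<in> S'") (auto simp: doubleton_eq_iff)
    qed
  qed
  have "(\<lambda>n. \<Sum>e\<in>F. ?t (S n) (f n) e) \<longlonglongrightarrow> (\<Sum>e\<in>F. ?t S' g e)"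
  proof (intro tendsto_sum tendsto_ennrealI tendsto_mult tendsto_const)
    fix e assume e: "e \<in> F"
    then have "e \<in> inner_edges G S' \<union> edge_boundary G S'" using F by auto
    moreover from this obtain v w where vw: "e = {v, w}" "v \<in> verts G" "w \<in> verts G" "e \<in> edges G"
      using edge_doubleton[OF G] by (metis (no_types, lifting) Un_iff edge_boundary_def inner_edges_def mem_Collect_eq)
    ultimately have "v \<in> S' \<union> vertex_boundary G S'" "w \<in> S' \<union> vertex_boundary G S'"
      by (auto simp: inner_edges_def edge_boundary_def vertex_boundary_def adjacent_def doubleton_eq_iff insert_commute)
    then have "(\<lambda>n. neumann_ext G (S n) (f n) v) \<longlonglongrightarrow> neumann_ext G S' g v"
      "(\<lambda>n. neumann_ext G (S n) (f n) w) \<longlonglongrightarrow> neumann_ext G S' g w"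
      by (auto intro!: neumann_ext_tendsto[where f = f and B = B] G S ev bd B lim)
    then show "(\<lambda>n. edge_diff_sq (neumann_ext G (S n) (f n)) e) \<longlonglongrightarrow> edge_diff_sq (neumann_ext G S' g) e"
      unfolding vw(1) edge_diff_sq_doubleton by (intro tendsto_intros)
  qed
  moreover have "\<forall>\<^sub>F n in sequentially. (\<Sum>e\<in>F. ?t (S n) (f n) e) \<le> b n"
    using evF
  proof eventually_elim
    case (elim n)
    have "(\<Sum>e\<in>F. ?t (S n) (f n) e) = (\<Sum>\<^sub>\<infinity>e\<in>F. ?t (S n) (f n) e)" using F by simp
    also have "\<dots> \<le> neumann_form G (S n) (f n)"
      unfolding neumann_form_def using elim by (intro infsum_mono_neutral nonneg_summable_on_complete) auto
    finally show ?case using le order_trans by blast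
  qed
  ultimately show "(\<Sum>e\<in>F. ?t S' g e) \<le> L"
    using b by (intro tendsto_le[OF trivial_limit_sequentially])
qed (rule nonneg_summable_on_complete, simp)

lemma neumann_energy_limit:
  fixes f :: "nat \<Rightarrow> 'a \<Rightarrow> complex"
  assumes G: "weighted_graph G" and fin: "vmeasure G (verts G) < \<infinity>"
    and S: "\<And>n. S n \<subseteq> verts G" "S' \<subseteq> verts G"
    and ev: "\<And>v. v \<in> verts G \<Longrightarrow> \<forall>\<^sub>F n in sequentially. v \<in> S n \<longleftrightarrow> v \<in> S'"
    and bd: "\<And>n v. v \<in> S n \<Longrightarrow> cmod (f n v) \<le> B" and B: "0 \<le> B"
    and mean: "\<And>n. mean_zero G (S n) (f n)" and norm1: "\<And>n. l2_norm_sq G (S n) (f n) = 1"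
    and le: "\<And>n. neumann_form G (S n) (f n) \<le> b n" and b: "b \<longlonglongrightarrow> L" and L: "L < \<infinity>"
  shows "S' \<noteq> {}" "neumann_energy G S' \<le> L"
proof -
  let ?V = "verts G"
  have V: "countable ?V" and \<nu>: "\<And>v. v \<in> ?V \<Longrightarrow> 0 < vweight G v"
    using G by (auto simp: weighted_graph_def)
  note sum\<nu> = vweight_summable[OF G fin]
  \<comment> \<open>Extension by zero puts all competitors on V. It also makes the pointwise limit
    vanish off \<open>S'\<close>, because each vertex there eventually leaves the sets
    \<open>S n\<close>.\<close>
  define h where "h n v = (if v \<in> S n then f n v else 0)" for n v
  have hB: "cmod (h n v) \<le> B" for n v using bd B by (simp add: h_def)
  \<comment> \<open>A diagonal argument over the countable set V, using the bound
    \<open>B\<close>.\<close>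
  obtain r where r: "strict_mono r" "\<And>v. v \<in> ?V \<Longrightarrow> \<exists>l. (\<lambda>n. h (r n) v) \<longlonglongrightarrow> l"
    using function_convergent_subsequence[OF V, of h B] hB by metis
  then obtain g where g: "\<And>v. v \<in> ?V \<Longrightarrow> (\<lambda>n. h (r n) v) \<longlonglongrightarrow> g v" by metis
  have evr: "\<forall>\<^sub>F n in sequentially. v \<in> S (r n) \<longleftrightarrow> v \<in> S'" if "v \<in> ?V" for v
    using eventually_subseq[OF r(1) ev[OF that]] .
  have g0: "g v = 0" if "v \<in> ?V - S'" for v
  proof -
    have "\<forall>\<^sub>F n in sequentially. h (r n) v = 0"
      using evr[of v] that by (auto simp: h_def elim!: eventually_mono)
    then show ?thesis using g[of v] that tendsto_eventually LIMSEQ_unique by (metis DiffD1)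
  qed
  have gB: "cmod (g v) \<le> B" if "v \<in> ?V" for v
    using hB by (intro LIMSEQ_le_const2[OF tendsto_norm[OF g[OF that]]]) auto
  have glim: "(\<lambda>n. f (r n) v) \<longlonglongrightarrow> g v" if "v \<in> S'" for v
  proof (rule Lim_transform_eventually)
    show "(\<lambda>n. h (r n) v) \<longlonglongrightarrow> g v" using g that S by auto
    have "v \<in> ?V" using that S by blast
    from evr[OF this] show "\<forall>\<^sub>F n in sequentially. h (r n) v = f (r n) v"
      by eventually_elim (use that in \<open>simp add: h_def\<close>)
  qed
  have formL: "neumann_form G S' g \<le> L"
    by (rule neumann_form_lower_semicontinuous[where S = "\<lambda>n. S (r n)" and f = "\<lambda>n. f (r n)" and b = "\<lambda>n. b (r n)" and B = B])
      (use G S evr bd B glim le LIMSEQ_subseq_LIMSEQ[OF b r(1)] in \<open>auto simp: o_def\<close>)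
  \<comment> \<open>Stated for a general set so as to apply both to \<open>S n\<close> and to
    \<open>S'\<close>; the bound \<open>B\<close> and the finite measure make the real-valued sum
    converge.\<close>
  have l2h: "l2_norm_sq G T u = ennreal (\<Sum>\<^sub>\<infinity>v\<in>?V. vweight G v * (cmod (u' v))\<^sup>2)"
    if T: "T \<subseteq> ?V" and u: "\<And>v. v \<in> T \<Longrightarrow> u' v = u v" "\<And>v. v \<in> ?V - T \<Longrightarrow> u' v = 0"
      and uB: "\<And>v. v \<in> ?V \<Longrightarrow> cmod (u' v) \<le> B" for T and u u' :: "'a \<Rightarrow> complex"
  proof -
    have "l2_norm_sq G T u = (\<Sum>\<^sub>\<infinity>v\<in>?V. ennreal (vweight G v * (cmod (u' v))\<^sup>2))"
      unfolding l2_norm_sq_def using T u by (intro infsum_cong_neutral) auto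
    also have "\<dots> = ennreal (\<Sum>\<^sub>\<infinity>v\<in>?V. vweight G v * (cmod (u' v))\<^sup>2)"
    proof (rule infsum_ennreal)
      show "(\<lambda>v. vweight G v * (cmod (u' v))\<^sup>2) summable_on ?V"
        by (rule summable_on_comparison_test[OF summable_on_cmult_left[OF sum\<nu>, of "B\<^sup>2"]])
          (use \<nu> uB in \<open>auto simp: less_imp_le intro!: mult_left_mono power_mono\<close>)
    qed (use \<nu> in \<open>auto simp: less_imp_le\<close>)
    finally show ?thesis .
  qed
  have l2n: "(\<Sum>\<^sub>\<infinity>v\<in>?V. vweight G v * (cmod (h n v))\<^sup>2) = 1" for n
  proof -
    have "ennreal (\<Sum>\<^sub>\<infinity>v\<in>?V. vweight G v * (cmod (h n v))\<^sup>2) = 1"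
      
      using l2h[OF S(1)[of n], where u' = "h n" and u = "f n"] hB norm1[of n] by (simp add: h_def)
    then show ?thesis by (simp add: infsum_nonneg \<nu> less_imp_le ennreal_eq_1)
  qed
  have "(\<lambda>n. \<Sum>\<^sub>\<infinity>v\<in>?V. vweight G v * (cmod (h (r n) v))\<^sup>2) \<longlonglongrightarrow> (\<Sum>\<^sub>\<infinity>v\<in>?V. vweight G v * (cmod (g v))\<^sup>2)"
  proof (rule infsum_tendsto_dominated[OF summable_on_cmult_left[OF sum\<nu>, of "B\<^sup>2"]])
    show "norm (vweight G v * (cmod (h (r n) v))\<^sup>2) \<le> vweight G v * B\<^sup>2" if "v \<in> ?V" for n v
      using \<nu>[OF that] hB[of "r n" v] by (auto simp: abs_mult intro!: mult_left_mono power_mono)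
  qed (intro tendsto_intros g)
  then have "(\<Sum>\<^sub>\<infinity>v\<in>?V. vweight G v * (cmod (g v))\<^sup>2) = 1"
    by (simp add: l2n LIMSEQ_const_iff)
  then have l2g: "l2_norm_sq G S' g = 1"
    using l2h[OF S(2), where u = g and u' = g] g0 gB by simp
  have meann: "(\<Sum>\<^sub>\<infinity>v\<in>?V. complex_of_real (vweight G v) * h n v) = 0" for n
  proof -
    have "(\<Sum>\<^sub>\<infinity>v\<in>?V. complex_of_real (vweight G v) * h n v)
        = (\<Sum>\<^sub>\<infinity>v\<in>S n. complex_of_real (vweight G v) * f n v)"
      using S by (intro infsum_cong_neutral) (auto simp: h_def)
    then show ?thesis using mean infsumI by (force simp: mean_zero_def)
  qed
  have "(\<lambda>n. \<Sum>\<^sub>\<infinity>v\<in>?V. complex_of_real (vweight G v) * h (r n) v) \<longlonglongrightarrow> (\<Sum>\<^sub>\<infinity>v\<in>?V. complex_of_real (vweight G v) * g v)"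
  proof (rule infsum_tendsto_dominated[OF summable_on_cmult_left[OF sum\<nu>, of B]])
    show "norm (complex_of_real (vweight G v) * h (r n) v) \<le> vweight G v * B" if "v \<in> ?V" for n v
      using \<nu>[OF that] hB[of "r n" v] by (auto simp: norm_mult)
  qed (intro tendsto_intros g)
  then have "(\<Sum>\<^sub>\<infinity>v\<in>?V. complex_of_real (vweight G v) * g v) = 0"
    by (simp add: meann LIMSEQ_const_iff)
  moreover have "(\<lambda>v. complex_of_real (vweight G v) * g v) summable_on ?V"
    by (rule abs_summable_summable, rule summable_on_comparison_test[OF summable_on_cmult_left[OF sum\<nu>, of B]])
      (use \<nu> gB in \<open>auto simp: norm_mult less_imp_le intro!: mult_left_mono\<close>)
  ultimately have "((\<lambda>v. complex_of_real (vweight G v) * g v) has_sum 0) ?V"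
    using has_sum_infsum by fastforce
  then have meang: "mean_zero G S' g"
    unfolding mean_zero_def
    by (subst has_sum_cong_neutral[where T = ?V and g = "\<lambda>v. complex_of_real (vweight G v) * g v"])
      (use g0 S in auto)
  have dom: "g \<in> neumann_domain G S'"
    unfolding neumann_domain_def mem_Collect_eq
  proof (intro conjI ballI)
    fix v assume "v \<in> vertex_boundary G S'"
    then have v: "v \<in> ?V - S'" by (auto simp: vertex_boundary_def)
    \<comment> \<open>A bounded function is absolutely summable against the edge weights at
      \<open>v\<close>.\<close>
    have "(\<lambda>w. eweight G {v, w} * B) summable_on {w \<in> S'. adjacent G v w}"
      using eweight_summable[OF G, of v] v
      by (intro summable_on_cmult_left) (auto intro: summable_on_subset_banach)
    then show "(\<lambda>w. cmod (complex_of_real (eweight G {v, w}) * g w)) summable_on boundary_neighbours G S' v"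
      unfolding boundary_neighbours_eq[OF S(2) v]
    proof (rule summable_on_comparison_test)
      fix w assume w: "w \<in> {w \<in> S'. adjacent G v w}"
      then have "0 < eweight G {v, w}" using G by (auto simp: weighted_graph_def adjacent_def)
      then show "cmod (complex_of_real (eweight G {v, w}) * g w) \<le> eweight G {v, w} * B"
        using gB[of w] w S by (auto simp: norm_mult)
    qed simp
  qed (use l2g formL L in auto)
  have nz: "\<exists>v\<in>S'. g v \<noteq> 0"
  proof (rule ccontr)
    assume "\<not> ?thesis"
    then have "l2_norm_sq G S' g = 0" by (auto simp: l2_norm_sq_def intro!: infsum_0)
    then show False using l2g by simp
  qed
  then show "S' \<noteq> {}" by auto
  \<comment> \<open>On a single vertex of positive weight, mean zero forces the value 0, against the
    norm 1. A singleton would have infinite energy and break the bound.\<close>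
  have "card S' \<noteq> 1"
  proof
    assume "card S' = 1"
    then obtain v where v: "S' = {v}" by (auto simp: card_1_singleton_iff)
    then have "((\<lambda>v. complex_of_real (vweight G v) * g v) has_sum (complex_of_real (vweight G v) * g v)) S'"
      using has_sum_finite[of S' "\<lambda>v. complex_of_real (vweight G v) * g v"] by simp
    then have "complex_of_real (vweight G v) * g v = 0"
      using meang unfolding mean_zero_def by (rule has_sum_unique)
    then show False using nz v \<nu>[of v] S by auto
  qed
  then have "neumann_energy G S' \<le> neumann_form G S' g / l2_norm_sq G S' g"
    unfolding neumann_energy_def using dom nz meang by (simp only: if_False) (blast intro: Inf_lower)
  then show "neumann_energy G S' \<le> L" using l2g formL by (simp add: divide_ennreal_def)
qed

section \<open>Partition energies\<close>

lemma ennpowr_ennreal: "0 \<le> x \<Longrightarrow> ennpowr (ennreal x) r = ennreal (x powr r)"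
  by (simp add: ennpowr_def)

lemma ennpowr_mono:
  assumes "x \<le> y" "0 \<le> r"
  shows "ennpowr x r \<le> ennpowr y r"
proof (cases "y = \<infinity>")
  case False
  then have "x \<noteq> \<infinity>" using assms by (auto simp: top_unique)
  moreover have "enn2real x \<le> enn2real y"
    using assms False by (cases y) (auto intro: enn2real_leI)
  ultimately show ?thesis
    using assms False by (auto simp: ennpowr_def intro!: ennreal_leI powr_mono2)
qed (simp add: ennpowr_def)

text \<open>This is where (i) acts: convergent energies bound the forms of near-minimisers, and a
  constant \<open>C\<close> common to all connected sets turns this into a sup bound uniform in
  \<open>n\<close>.\<close>

lemma neumann_energy_lower_semicontinuous:
  assumes G: "weighted_graph G" and fin: "vmeasure G (verts G) < \<infinity>"
    and C: "\<And>S f. induces_connected G S \<Longrightarrow> f \<in> neumann_domain G S \<Longrightarrow> mean_zero G S f \<Longrightarrow>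
             (SUP v\<in>S. ennreal (cmod (f v))) \<le> ennreal C * ennpowr (neumann_form G S f) (1 / 2)"
    and con: "\<And>n. induces_connected G (S n)" and S': "S' \<subseteq> verts G"
    and ev: "\<And>v. v \<in> verts G \<Longrightarrow> \<forall>\<^sub>F n in sequentially. v \<in> S n \<longleftrightarrow> v \<in> S'"
    and a: "\<And>n. neumann_energy G (S n) = ennreal (a n)" "\<And>n. 0 \<le> a n" "a \<longlonglongrightarrow> L"
  shows "S' \<noteq> {}" "neumann_energy G S' \<le> ennreal L"
proof -
  have S: "S n \<subseteq> verts G" for n using con by (auto simp: induces_connected_def)
  \<comment> \<open>The positive slack makes the bound strict, so a competitor exists, and it
    vanishes in the limit.\<close>
  define b where "b n = a n + inverse (real (Suc n))" for n
  have "neumann_energy G (S n) < ennreal (b n)" for n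
    using a(1,2) by (simp add: b_def ennreal_less_iff)
  then have "\<exists>f. f \<in> neumann_domain G (S n) \<and> mean_zero G (S n) f \<and> l2_norm_sq G (S n) f = 1 \<and>
     neumann_form G (S n) f \<le> ennreal (b n)" for n
    using normalised_near_minimiser[OF G S] by metis
  then obtain f where f: "\<And>n. f n \<in> neumann_domain G (S n)" "\<And>n. mean_zero G (S n) (f n)"
    "\<And>n. l2_norm_sq G (S n) (f n) = 1" "\<And>n. neumann_form G (S n) (f n) \<le> ennreal (b n)"
    by metis
  have bL: "b \<longlonglongrightarrow> L"
    using tendsto_add[OF a(3) LIMSEQ_inverse_real_of_nat] by (simp add: b_def[abs_def])
  then obtain M where M: "\<And>n. \<bar>b n\<bar> \<le> M"
    using convergent_imp_Bseq[of b] by (auto simp: convergent_def Bseq_def)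
  have M0: "0 \<le> M" using M[of 0] by linarith
  \<comment> \<open>\<open>M\<close> bounds the forms, so (i) gives this sup bound; the absolute
    value appears because \<open>C\<close> carries no sign assumption here.\<close>
  define B where "B = \<bar>C\<bar> * M powr (1 / 2)"
  have bd: "cmod (f n v) \<le> B" if "v \<in> S n" for n v
  proof -
    have "ennreal (cmod (f n v)) \<le> (SUP v\<in>S n. ennreal (cmod (f n v)))"
      using that by (rule SUP_upper)
    also have "\<dots> \<le> ennreal C * ennpowr (neumann_form G (S n) (f n)) (1 / 2)"
      using con f by (intro C) auto
    also have "\<dots> \<le> ennreal \<bar>C\<bar> * ennpowr (ennreal M) (1 / 2)"
    proof (intro mult_mono ennpowr_mono)
      have "neumann_form G (S n) (f n) \<le> ennreal (b n)" using f by simp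
      also have "\<dots> \<le> ennreal M" using M[of n] by (intro ennreal_leI) auto
      finally show "neumann_form G (S n) (f n) \<le> ennreal M" .
    qed (auto intro: ennreal_leI)
    also have "\<dots> = ennreal B"
      using M0 by (simp add: ennpowr_ennreal B_def ennreal_mult)
    finally show ?thesis by (simp add: B_def)
  qed
  have "0 \<le> B" by (simp add: B_def)
  note lim = neumann_energy_limit[of G S S' f B "\<lambda>n. ennreal (b n)" "ennreal L",
      OF G fin S S' ev bd this f(2,3,4) tendsto_ennrealI[OF bL]]
  show "S' \<noteq> {}" "neumann_energy G S' \<le> ennreal L" using lim by auto
qed

lemma exponent_bounds:
  assumes "1 \<le> p" "p \<noteq> \<infinity>"
  shows "1 \<le> enn2real p"
  using assms by (cases p) auto

text \<open>A minimising sequence controls only the averaged energy; this bounds the energy of each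
  single part. The factor \<open>k\<close> is a crude common bound for 1 (when \<open>p\<close> is
  infinite) and for the \<open>p\<close>-th root of \<open>k\<close>.\<close>

lemma neumann_energy_le_partition_energy:
  assumes k: "1 \<le> k" and p: "1 \<le> p" and j: "j \<in> {1..k}"
  shows "neumann_energy G (P j) \<le> of_nat k * partition_energy G k p P"
proof (cases "p = \<infinity>")
  case True
  then have "neumann_energy G (P j) \<le> partition_energy G k p P"
    using j by (auto simp: partition_energy_def intro!: Max_ge)
  also have "\<dots> = 1 * \<dots>" by simp
  also have "\<dots> \<le> of_nat k * partition_energy G k p P"
    using of_nat_mono[OF k, where 'a = ennreal] by (intro mult_right_mono) auto
  finally show ?thesis .
next
  case False
  define q where "q = enn2real p"
  have q: "1 \<le> q" using exponent_bounds[OF p False] by (simp add: q_def)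
  define T where "T = (\<Sum>j=1..k. ennpowr (neumann_energy G (P j)) q) / of_nat k"
  have E: "partition_energy G k p P = ennpowr T (1 / q)"
    using False by (simp add: partition_energy_def T_def q_def)
  show ?thesis
  proof (cases "T = \<infinity>")
    case True
    then show ?thesis using k by (simp add: E ennpowr_def ennreal_mult_top)
  next
    case False
    then obtain t where t: "T = ennreal t" "0 \<le> t" by (cases T) auto
    have "ennpowr (neumann_energy G (P j)) q \<le> (\<Sum>j=1..k. ennpowr (neumann_energy G (P j)) q)"
      using j by (intro member_le_sum) auto
    also have "\<dots> = (\<Sum>j=1..k. ennpowr (neumann_energy G (P j)) q) * of_nat k / of_nat k"
      using k by (intro mult_divide_eq_ennreal[symmetric]) auto
    also have "\<dots> = of_nat k * T"
      by (simp only: T_def ennreal_times_divide mult.commute)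
    also have "\<dots> = ennreal (real k * t)"
      using t by (simp add: ennreal_mult ennreal_of_nat_eq_real_of_nat)
    finally have le: "ennpowr (neumann_energy G (P j)) q \<le> ennreal (real k * t)" .
    then have "neumann_energy G (P j) \<noteq> \<infinity>" by (auto simp: ennpowr_def top_unique)
    then obtain x where x: "neumann_energy G (P j) = ennreal x" "0 \<le> x"
      by (cases "neumann_energy G (P j)") auto
    have "x powr q \<le> real k * t" using le x t by (simp add: ennpowr_ennreal)
    then have "(x powr q) powr (1 / q) \<le> (real k * t) powr (1 / q)"
      using q by (intro powr_mono2) auto
    then have "x \<le> real k powr (1 / q) * t powr (1 / q)"
      using q x t by (simp add: powr_powr powr_mult)
    \<comment> \<open>Both \<open>k\<close> and \<open>q\<close> are at least 1, so the
      \<open>q\<close>-th root of \<open>k\<close> is at most \<open>k\<close>.\<close>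
    also have "\<dots> \<le> real k powr 1 * t powr (1 / q)"
      using k q by (intro mult_right_mono powr_mono) auto
    finally show ?thesis
      using x t k by (simp add: E ennpowr_ennreal ennreal_of_nat_eq_real_of_nat flip: ennreal_mult)
  qed
qed

text \<open>For finite \<open>p\<close> the averaging functional is monotone and continuous on
  nonnegative vectors: its value at \<open>L\<close> bounds the energy of \<open>P'\<close> and is
  the limit of the energies of \<open>P n\<close>. The maximum is handled one part at a
  time.\<close>

lemma partition_energy_lower_semicontinuous:
  assumes k: "1 \<le> k" and p: "1 \<le> p"
    and a: "\<And>n j. j \<in> {1..k} \<Longrightarrow> neumann_energy G (P n j) = ennreal (a n j)" "\<And>n j. 0 \<le> a n j"
    and lim: "\<And>j. j \<in> {1..k} \<Longrightarrow> (\<lambda>n. a n j) \<longlonglongrightarrow> L j"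
    and le: "\<And>j. j \<in> {1..k} \<Longrightarrow> neumann_energy G (P' j) \<le> ennreal (L j)"
    and b: "\<And>n. partition_energy G k p (P n) \<le> b n" "b \<longlonglongrightarrow> I"
  shows "partition_energy G k p P' \<le> I"
proof (cases "p = \<infinity>")
  case True
  have "neumann_energy G (P' j) \<le> I" if j: "j \<in> {1..k}" for j
  proof -
    have "ennreal (a n j) \<le> b n" for n
    proof -
      have "ennreal (a n j) \<le> partition_energy G k p (P n)"
        using True j a(1)[OF j, of n, symmetric] by (auto simp: partition_energy_def intro!: Max_ge)
      then show ?thesis using b(1) order_trans by blast
    qed
    then have "ennreal (L j) \<le> I"
      by (intro LIMSEQ_le[OF tendsto_ennrealI[OF lim[OF j]] b(2)]) auto
    then show ?thesis using le[OF j] by simp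
  qed
  then show ?thesis using True k by (auto simp: partition_energy_def)
next
  case False
  define q where "q = enn2real p"
  have q: "1 \<le> q" using exponent_bounds[OF p False] by (simp add: q_def)
  define F where "F x = ((\<Sum>j=1..k. x j powr q) / real k) powr (1 / q)" for x :: "nat \<Rightarrow> real"
  have L: "0 \<le> L j" if "j \<in> {1..k}" for j
    using a(2) by (intro LIMSEQ_le_const[OF lim[OF that]]) auto
  have F: "ennpowr ((\<Sum>j=1..k. ennpowr (ennreal (x j)) q) / of_nat k) (1 / q) = ennreal (F x)"
    if "\<And>j. j \<in> {1..k} \<Longrightarrow> 0 \<le> x j" for x
  proof -
    have "(\<Sum>j=1..k. ennpowr (ennreal (x j)) q) = (\<Sum>j=1..k. ennreal (x j powr q))"
      using that by (intro sum.cong) (auto simp: ennpowr_ennreal)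
    also have "\<dots> = ennreal (\<Sum>j=1..k. x j powr q)" by (rule sum_ennreal) auto
    finally show ?thesis
      using k by (simp add: F_def ennpowr_ennreal ennreal_of_nat_eq_real_of_nat divide_ennreal sum_nonneg)
  qed
  have "partition_energy G k p (P n) = ennreal (F (a n))" for n
  proof -
    have "(\<Sum>j=1..k. ennpowr (neumann_energy G (P n j)) q) = (\<Sum>j=1..k. ennpowr (ennreal (a n j)) q)"
      using a by (intro sum.cong) auto
    then show ?thesis using False F[of "a n"] a(2) by (simp add: partition_energy_def q_def)
  qed
  then have "ennreal (F (a n)) \<le> b n" for n using b(1)[of n] by simp
  moreover have "(\<lambda>n. F (a n)) \<longlonglongrightarrow> F L"
    unfolding F_def
  \<comment> \<open>The base may tend to 0, where continuity of \<open>powr\<close> rests on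
    nonnegative bases and the positive exponents \<open>q\<close> and \<open>1 / q\<close>.\<close>
  proof (intro tendsto_powr' tendsto_divide tendsto_sum tendsto_const)
    show "(\<lambda>n. a n j) \<longlonglongrightarrow> L j" if "j \<in> {1..k}" for j using lim that .
  qed (use q k a(2) in \<open>auto intro!: always_eventually sum_nonneg divide_nonneg_nonneg\<close>)
  then have "(\<lambda>n. ennreal (F (a n))) \<longlonglongrightarrow> ennreal (F L)" by (rule tendsto_ennrealI)
  ultimately have "ennreal (F L) \<le> I"
    by (intro LIMSEQ_le[OF _ b(2)]) auto
  moreover have "partition_energy G k p P' \<le> ennreal (F L)"
  proof -
    have "partition_energy G k p P' = ennpowr ((\<Sum>j=1..k. ennpowr (neumann_energy G (P' j)) q) / of_nat k) (1 / q)"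
      using False by (simp add: partition_energy_def q_def)
    also have "\<dots> \<le> ennpowr ((\<Sum>j=1..k. ennpowr (ennreal (L j)) q) / of_nat k) (1 / q)"
      using q le by (intro ennpowr_mono divide_right_mono_ennreal sum_mono) auto
    also have "\<dots> = ennreal (F L)" using L by (rule F)
    finally show ?thesis .
  qed
  ultimately show ?thesis by (rule order_trans[rotated])
qed

section \<open>Existence of an optimal partition\<close>

lemma convergent_nat_eventually_const:
  assumes "(\<lambda>n. real (x n)) \<longlonglongrightarrow> l"
  obtains c where "\<forall>\<^sub>F n in sequentially. x n = c"
proof -
  \<comment> \<open>With tolerance 1/2, two late terms differ by less than 1, and both are
    integers.\<close>
  obtain N where N: "\<And>n. n \<ge> N \<Longrightarrow> dist (real (x n)) l < 1 / 2"
    using LIMSEQ_D[OF assms, of "1 / 2"] by (auto simp: dist_norm)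
  have "x n = x N" if "n \<ge> N" for n
    using N[OF that] N[of N] by (simp add: dist_real_def abs_if split: if_splits)
  then show thesis by (intro that[of "x N"] eventually_sequentiallyI)
qed

theorem theorem3p12:
  fixes G :: "'a wgraph" and k :: nat and p :: ennreal
  assumes "1 \<le> k"
    and "finite (verts G) \<longrightarrow> k \<le> card (verts G)"
    and "1 \<le> p"
    and "weighted_graph G"
    and "vmeasure G (verts G) < \<infinity>"
    and "\<exists>C::real. C > 0 \<and>
          (\<forall>S f. S \<subseteq> verts G \<and> induces_connected G S \<and> f \<in> neumann_domain G S \<and> mean_zero G S f \<longrightarrow>
             (SUP v\<in>S. ennreal (cmod (f v))) \<le> ennreal C * ennpowr (neumann_form G S f) (1 / 2))"
    and "\<forall>v\<in>verts G. \<forall>w\<in>verts G. v \<noteq> w \<longrightarrow>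
          finite {xs. graph_path G v w xs \<and> non_contractible G xs}"
  shows "\<exists>P\<in>connected_partitions G k. optimal_energy G k p = partition_energy G k p P"
proof (cases "optimal_energy G k p = \<infinity>")
  case True
  \<comment> \<open>An infinite infimum gives every connected partition infinite energy, so any one
    is optimal.\<close>
  obtain P where P: "P \<in> connected_partitions G k"
    using connected_partitions_nonempty[OF _ assms(1,2)] assms(4) by (auto simp: weighted_graph_def)
  then have "optimal_energy G k p \<le> partition_energy G k p P"
    unfolding optimal_energy_def by (rule INF_lower)
  then show ?thesis using P True by (intro bexI[of _ P]) (auto simp: top_unique)
next
  case False
  note k = assms(1) and p = assms(3) and G = assms(4) and fin = assms(5)
  let ?V = "verts G"
  obtain I where I: "optimal_energy G k p = ennreal I" "0 \<le> I"
    using False by (cases "optimal_energy G k p") auto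
  obtain C where "\<forall>S f. S \<subseteq> ?V \<and> induces_connected G S \<and> f \<in> neumann_domain G S \<and> mean_zero G S f \<longrightarrow>
      (SUP v\<in>S. ennreal (cmod (f v))) \<le> ennreal C * ennpowr (neumann_form G S f) (1 / 2)"
    using assms(6) by blast
  moreover have "S \<subseteq> ?V" if "induces_connected G S" for S
    using that by (simp add: induces_connected_def)
  ultimately have C: "\<And>S f. induces_connected G S \<Longrightarrow> f \<in> neumann_domain G S \<Longrightarrow> mean_zero G S f \<Longrightarrow>
      (SUP v\<in>S. ennreal (cmod (f v))) \<le> ennreal C * ennpowr (neumann_form G S f) (1 / 2)"
    by blast
  define b where "b n = I + inverse (real (Suc n))" for n
  have "\<exists>P\<in>connected_partitions G k. partition_energy G k p P < ennreal (b n)" for n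
  proof -
    have "optimal_energy G k p < ennreal (b n)" using I by (simp add: b_def ennreal_less_iff)
    then show ?thesis unfolding optimal_energy_def INF_less_iff .
  qed
  then obtain P where PC: "\<And>n. P n \<in> connected_partitions G k"
    and Pb: "\<And>n. partition_energy G k p (P n) < ennreal (b n)" by metis
  have disj: "disjoint_family_on (P n) {1..k}" and un: "(\<Union>j\<in>{1..k}. P n j) = ?V" for n
    using PC[of n] by (auto simp: connected_partitions_def)
  have con: "induces_connected G (P n j)" if "j \<in> {1..k}" for n j
    using PC[of n] that by (auto simp: connected_partitions_def)
  have "\<exists>j\<in>{1..k}. v \<in> P n j" if "v \<in> ?V" for n v using un[of n] that by auto
  then have "\<exists>j. j \<in> {1..k} \<and> v \<in> P n j" if "v \<in> ?V" for n v using that by blast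
  note idx_ex = someI_ex[OF this]
  \<comment> \<open>The partition read as a labelling of the vertices; labels are bounded by
    \<open>k\<close>, so subsequences can be extracted from them as real numbers.\<close>
  define idx where "idx n v = (SOME j. j \<in> {1..k} \<and> v \<in> P n j)" for n v
  have idx: "idx n v \<in> {1..k}" "v \<in> P n (idx n v)" if "v \<in> ?V" for n v
    using idx_ex[OF that, of n] unfolding idx_def by blast+
  have idx_iff: "v \<in> P n j \<longleftrightarrow> idx n v = j" if "v \<in> ?V" "j \<in> {1..k}" for n v j
    using idx[OF that(1), of n] disjoint_family_onD[OF disj[of n], of "idx n v" j] that by auto
  define a where "a n j = enn2real (neumann_energy G (P n j))" for n j
  \<comment> \<open>The slack in \<open>b n\<close> is at most 1, hence \<open>I + 1\<close>. The
    bound also excludes the value infinity, so that \<open>enn2real\<close> loses nothing.\<close>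
  have a_le: "neumann_energy G (P n j) \<le> ennreal (real k * (I + 1))" if "j \<in> {1..k}" for n j
  proof -
    have "neumann_energy G (P n j) \<le> of_nat k * partition_energy G k p (P n)"
      using neumann_energy_le_partition_energy[OF k p that] .
    also have "partition_energy G k p (P n) \<le> ennreal (I + 1)"
      using Pb[of n] by (rule order_trans[OF less_imp_le ennreal_leI]) (simp add: b_def inverse_le_1_iff)
    finally show ?thesis using I by (simp add: ennreal_mult ennreal_of_nat_eq_real_of_nat mult_left_mono)
  qed
  have a: "neumann_energy G (P n j) = ennreal (a n j)" if "j \<in> {1..k}" for n j
    using a_le[OF that, of n] by (auto simp: a_def ennreal_enn2real_if top_unique)
  have a_nn: "0 \<le> a n j" for n j by (simp add: a_def)
  have a_bd: "norm (a n j) \<le> real k * (I + 1)" if "j \<in> {1..k}" for n j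
    using a_le[OF that, of n] I a_nn by (simp add: a[OF that])
  have "countable ?V" using G by (simp add: weighted_graph_def)
  then obtain r1 where r1: "strict_mono r1" "\<And>v. v \<in> ?V \<Longrightarrow> \<exists>l. (\<lambda>n. real (idx (r1 n) v)) \<longlonglongrightarrow> l"
    by (rule function_convergent_subsequence[where f = "\<lambda>n v. real (idx n v)" and M = "real k"])
      (use idx(1) in auto)
  \<comment> \<open>A further extraction makes the \<open>k\<close> energies converge; the labels
    stay eventually constant along it.\<close>
  have "countable {1..k}" by simp
  then obtain r2 where r2: "strict_mono r2" "\<And>j. j \<in> {1..k} \<Longrightarrow> \<exists>l. (\<lambda>n. a (r1 (r2 n)) j) \<longlonglongrightarrow> l"
    by (rule function_convergent_subsequence[where f = "\<lambda>n. a (r1 n)" and M = "real k * (I + 1)"])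
      (use a_bd in auto)
  then obtain L where L: "\<And>j. j \<in> {1..k} \<Longrightarrow> (\<lambda>n. a (r1 (r2 n)) j) \<longlonglongrightarrow> L j" by metis
  define r where "r n = r1 (r2 n)" for n
  have r: "strict_mono r" using strict_mono_o[OF r1(1) r2(1)] by (simp add: r_def[abs_def] o_def)
  have "\<exists>c. \<forall>\<^sub>F n in sequentially. idx (r n) v = c" if v: "v \<in> ?V" for v
  proof -
    obtain l where "(\<lambda>n. real (idx (r1 n) v)) \<longlonglongrightarrow> l" using r1(2)[OF v] by blast
    then obtain c where "\<forall>\<^sub>F n in sequentially. idx (r1 n) v = c"
      by (rule convergent_nat_eventually_const)
    then show ?thesis using eventually_subseq[OF r2(1)] by (auto simp: r_def)
  qed
  then obtain c where c: "\<And>v. v \<in> ?V \<Longrightarrow> \<forall>\<^sub>F n in sequentially. idx (r n) v = c v" by metis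
  define P' where "P' j = {v \<in> ?V. c v = j}" for j
  have ev: "\<forall>\<^sub>F n in sequentially. v \<in> P (r n) j \<longleftrightarrow> v \<in> P' j" if "v \<in> ?V" "j \<in> {1..k}" for v j
    using c[OF that(1)] by eventually_elim (use that idx_iff in \<open>auto simp: P'_def\<close>)
  \<comment> \<open>The eventual label is attained at some \<open>n\<close>, so it is an index;
    hence the limit parts cover V.\<close>
  have c_range: "c v \<in> {1..k}" if "v \<in> ?V" for v
    using eventually_happens[OF c[OF that]] idx(1)[OF that] by (metis trivial_limit_sequentially)
  \<comment> \<open>Nonemptiness comes with the energy bound, since the norm 1 survives the limit;
    connectedness of \<open>P' j\<close> below relies on it.\<close>
  have lim: "P' j \<noteq> {} \<and> neumann_energy G (P' j) \<le> ennreal (L j)" if j: "j \<in> {1..k}" for j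
  proof -
    have P'V: "P' j \<subseteq> ?V" by (auto simp: P'_def)
    note lsc = neumann_energy_lower_semicontinuous[where S = "\<lambda>n. P (r n) j" and a = "\<lambda>n. a (r n) j",
        OF G fin C con[OF j] P'V ev[OF _ j] a[OF j] a_nn L[OF j, folded r_def]]
    show ?thesis by (intro conjI lsc)
  qed
  have "P' \<in> connected_partitions G k"
    unfolding connected_partitions_def mem_Collect_eq
  proof (intro conjI ballI)
    show "disjoint_family_on P' {1..k}" by (auto simp: disjoint_family_on_def P'_def)
    show "(\<Union>j\<in>{1..k}. P' j) = ?V" using c_range by (auto simp: P'_def)
    show "P' j \<noteq> {}" if "j \<in> {1..k}" for j using lim[OF that] by simp
    show "induces_connected G (P' j)" if j: "j \<in> {1..k}" for j
      by (rule induces_connected_limit[where S = "\<lambda>n. P (r n) j"])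
        (use con[OF j] ev[OF _ j] lim[OF j] assms(7) in \<open>auto simp: P'_def\<close>)
  qed
  moreover have "partition_energy G k p P' \<le> ennreal I"
  proof (rule partition_energy_lower_semicontinuous[OF k p, where P = "\<lambda>n. P (r n)" and a = "\<lambda>n. a (r n)"
        and L = L and b = "\<lambda>n. ennreal (b (r n))"])
    have "b \<longlonglongrightarrow> I"
      using tendsto_add[OF tendsto_const[of I] LIMSEQ_inverse_real_of_nat] by (simp add: b_def[abs_def])
    then have "(\<lambda>n. ennreal (b n)) \<longlonglongrightarrow> ennreal I" by (rule tendsto_ennrealI)
    from LIMSEQ_subseq_LIMSEQ[OF this r] show "(\<lambda>n. ennreal (b (r n))) \<longlonglongrightarrow> ennreal I" by (simp add: o_def)
  qed (use a a_nn L lim Pb in \<open>auto simp: r_def less_imp_le\<close>)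
  moreover have "optimal_energy G k p \<le> partition_energy G k p P'"
    unfolding optimal_energy_def using calculation(1) by (rule INF_lower)
  ultimately show ?thesis using I by (intro bexI[of _ P']) auto
qed

end
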